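(* Let $(\mathcal{B},\mathbb{E},\mathfrak{s})$ be an extriangulated category and let $((\mathcal{S},\mathcal{T}),(\mathcal{U},\mathcal{V}))$ be a twin cotorsion pair on $\mathcal{B}$ with heart $\underline{\mathcal{H}}$. If $\underline{\mathcal{H}}$ is abelian, then $\underline{\mathcal{H}_1}$ and $\underline{\mathcal{H}_2}$ are dense in $\underline{\mathcal{H}}$, i.e. every object of $\underline{\mathcal{H}}$ is isomorphic in $\underline{\mathcal{B}}$ to an object of $\underline{\mathcal{H}_1}$ and to an object of $\underline{\mathcal{H}_2}$. Moreover, if in addition $\mathcal{B}$ is Krull-Schmidt, then $\underline{\mathcal{H}}=\underline{\mathcal{H}_1}\cap\underline{\mathcal{H}_2}$ as (isomorphism-closed full) subcategories of $\underline{\mathcal{B}}$.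
   Context: Extriangulated categories (Nakaoka–Palu). Let $\mathcal{B}$ be an additive category with an additive bifunctor $\mathbb{E}:\mathcal{B}^{\mathrm{op}}\times\mathcal{B}\to\mathbf{Ab}$. For $\delta\in\mathbb{E}(C,A)$, $a:A\to A'$, $c:C'\to C$ write $a_*\delta=\mathbb{E}(C,a)(\delta)$, $c^*\delta=\mathbb{E}(c,A)(\delta)$. A morphism from $\delta\in\mathbb{E}(C,A)$ to $\delta'\in\mathbb{E}(C',A')$ is a pair $(a:A\to A',c:C\to C')$ with $a_*\delta=c^*\delta'$. Sequences $A\xrightarrow{x}B\xrightarrow{y}C$ and $A\xrightarrow{x'}B'\xrightarrow{y'}C$ are equivalent if there is an isomorphism $b:B\to B'$ with $bx=x'$, $y'b=y$. $\mathfrak{s}$ assigns to each $\delta\in\mathbb{E}(C,A)$ an equivalence class $\mathfrak{s}(\delta)=[A\xrightarrow{x}B\xrightarrow{y}C]$ such that every morphism $(a,c):\delta\to\delta'$ admits $b:B\to B'$ with $bx=x'a$, $y'b=cy$; moreover $\mathfrak{s}(0)=[A\to A\oplus C\to C]$ and $\mathfrak{s}(\delta\oplus\delta')=\mathfrak{s}(\delta)\oplus\mathfrak{s}(\delta')$. $(\mathcal{B},\mathbb{E},\mathfrak{s})$ is extriangulated if also: (ET3) given $\delta,\delta'$ realized by $A\xrightarrow{x}B\xrightarrow{y}C$, $A'\xrightarrow{x'}B'\xrightarrow{y'}C'$ and $a,b$ with $bx=x'a$, there is $c$ with $cy=y'b$ and $a_*\delta=c^*\delta'$; (ET4) if $\delta\in\mathbb{E}(D,A)$,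 $\delta'\in\mathbb{E}(F,B)$ are realized by $A\xrightarrow{f}B\xrightarrow{f'}D$, $B\xrightarrow{g}C\xrightarrow{g'}F$, there are an object $E$, morphisms $d:D\to E$, $e:E\to F$, $h':C\to E$ and $\delta''\in\mathbb{E}(E,A)$ realized by $A\xrightarrow{gf}C\xrightarrow{h'}E$ with $h'g=df'$, $eh'=g'$, $D\xrightarrow{d}E\xrightarrow{e}F$ realizing $f'_*\delta'$, $d^*\delta''=\delta$, $f_*\delta''=e^*\delta'$; and the duals (ET3)$^{\mathrm{op}}$, (ET4)$^{\mathrm{op}}$. If $\mathfrak{s}(\delta)=[A\xrightarrow{x}B\xrightarrow{y}C]$, then $A\xrightarrow{x}B\xrightarrow{y}C\overset{\delta}{\dashrightarrow}$ is called an $\mathbb{E}$-triangle. Twin cotorsion pairs and hearts. Subcategories are full and closed under isomorphisms. A cotorsion pair $(\mathcal{U},\mathcal{V})$ on $\mathcal{B}$ consists of two subcategories closed under direct summands with $\mathbb{E}(\mathcal{U},\mathcal{V})=0$ such that every $B\in\mathcal{B}$ has $\mathbb{E}$-triangles $V_B\to U_B\to B\dashrightarrow$ and $B\to V^B\to U^B\dashrightarrow$ with $U_B,U^B\in\mathcal{U}$, $V_B,V^B\in\mathcal{V}$. A twin cotorsion pair is a pair of cotorsion pairs $((\mathcal{S},\mathcal{T}),(\mathcal{U},\mathcal{V}))$ with $\mathcal{S}\subseteq\mathcal{U}$. Put $\mathcal{W}=\mathcal{T}\cap\mathcal{U}$ and $\underline{\mathcal{B}}=\mathcal{B}/\mathcal{W}$,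 the ideal quotient: same objects as $\mathcal{B}$, morphisms modulo those factoring through objects of $\mathcal{W}$. For a subcategory $\mathcal{D}$ of $\mathcal{B}$, $\underline{\mathcal{D}}$ denotes its image in $\underline{\mathcal{B}}$, regarded as a full subcategory closed under isomorphisms. Let $\mathcal{B}^+$ be the class of $X$ having an $\mathbb{E}$-triangle $V\to W\to X\dashrightarrow$ with $V\in\mathcal{V}$, $W\in\mathcal{W}$; $\mathcal{B}^-$ the class of $Y$ having an $\mathbb{E}$-triangle $Y\to W'\to S\dashrightarrow$ with $S\in\mathcal{S}$, $W'\in\mathcal{W}$; $\mathcal{H}=\mathcal{B}^+\cap\mathcal{B}^-$. The heart of the twin cotorsion pair is $\underline{\mathcal{H}}=\mathcal{H}/\mathcal{W}$. The single cotorsion pairs. $\mathcal{B}_1^+$ is the class of $X$ having an $\mathbb{E}$-triangle $T\to M\to X\dashrightarrow$ with $T\in\mathcal{T}$, $M\in\mathcal{S}\cap\mathcal{T}$; $\mathcal{B}_1^-$ the class of $Y$ having an $\mathbb{E}$-triangle $Y\to M'\to S\dashrightarrow$ with $S\in\mathcal{S}$, $M'\in\mathcal{S}\cap\mathcal{T}$; $\mathcal{H}_1=\mathcal{B}_1^+\cap\mathcal{B}_1^-$. $\mathcal{B}_2^+$ is the class of $X$ having an $\mathbb{E}$-triangle $V\to N\to X\dashrightarrow$ with $V\in\mathcal{V}$, $N\in\mathcal{U}\cap\mathcal{V}$; $\mathcal{B}_2^-$ the class of $Y$ having an $\mathbb{E}$-triangle $Y\to N'\to U\dashrightarrow$ with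 $U\in\mathcal{U}$, $N'\in\mathcal{U}\cap\mathcal{V}$; $\mathcal{H}_2=\mathcal{B}_2^+\cap\mathcal{B}_2^-$. (The heart of $(\mathcal{S},\mathcal{T})$ is $\mathcal{H}_1/(\mathcal{S}\cap\mathcal{T})=\underline{\mathcal{H}_1}$ and that of $(\mathcal{U},\mathcal{V})$ is $\mathcal{H}_2/(\mathcal{U}\cap\mathcal{V})=\underline{\mathcal{H}_2}$.) *)

theory Defs
  imports "HOL-Algebra.Coset" "HOL-Algebra.FiniteProduct" "HOL-Algebra.Ring"
begin

section \<open>Additive and abelian categories\<close>

text \<open>
  The hom-sets are groups in the sense of HOL-Algebra, which are written multiplicatively:
  the sum of two parallel morphisms is their \<open>\<otimes>\<close>-product in \<open>Hom C A B\<close>, and the zero morphism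
  is \<open>\<one>\<close> of that group. The extension groups \<open>Ext \<B> C A\<close> below follow the same convention.
\<close>

record ('o, 'm) cat =
  Obj :: "'o set"
  Hom :: "'o \<Rightarrow> 'o \<Rightarrow> 'm monoid"
  Cmp :: "'m \<Rightarrow> 'm \<Rightarrow> 'm"  (infixl \<open>\<cdot>\<index>\<close> 70)
  Ident :: "'o \<Rightarrow> 'm"

abbreviation hom_set :: "('o, 'm, 'z) cat_scheme \<Rightarrow> 'o \<Rightarrow> 'o \<Rightarrow> 'm set" where
  "hom_set C A B \<equiv> carrier (Hom C A B)"

abbreviation zero_mor :: "('o, 'm, 'z) cat_scheme \<Rightarrow> 'o \<Rightarrow> 'o \<Rightarrow> 'm" where
  "zero_mor C A B \<equiv> \<one>\<^bsub>Hom C A B\<^esub>"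

locale category =
  fixes C :: "('o, 'm, 'z) cat_scheme" (structure)
  assumes hom_disjoint:
      "\<lbrakk>A \<in> Obj C; B \<in> Obj C; A' \<in> Obj C; B' \<in> Obj C; f \<in> hom_set C A B; f \<in> hom_set C A' B'\<rbrakk>
        \<Longrightarrow> A = A' \<and> B = B'"
    and ident_closed: "A \<in> Obj C \<Longrightarrow> Ident C A \<in> hom_set C A A"
    and cmp_closed:
      "\<lbrakk>A \<in> Obj C; B \<in> Obj C; D \<in> Obj C; f \<in> hom_set C A B; g \<in> hom_set C B D\<rbrakk>
        \<Longrightarrow> g \<cdot> f \<in> hom_set C A D"
    and cmp_ident_left:
      "\<lbrakk>A \<in> Obj C; B \<in> Obj C; f \<in> hom_set C A B\<rbrakk> \<Longrightarrow> Ident C B \<cdot> f = f"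
    and cmp_ident_right:
      "\<lbrakk>A \<in> Obj C; B \<in> Obj C; f \<in> hom_set C A B\<rbrakk> \<Longrightarrow> f \<cdot> Ident C A = f"
    and cmp_assoc:
      "\<lbrakk>A \<in> Obj C; B \<in> Obj C; D \<in> Obj C; E \<in> Obj C;
        f \<in> hom_set C A B; g \<in> hom_set C B D; h \<in> hom_set C D E\<rbrakk>
        \<Longrightarrow> (h \<cdot> g) \<cdot> f = h \<cdot> (g \<cdot> f)"

locale preadditive_category = category +
  assumes hom_comm_group: "\<lbrakk>A \<in> Obj C; B \<in> Obj C\<rbrakk> \<Longrightarrow> comm_group (Hom C A B)"
    and cmp_additive_left:
      "\<lbrakk>A \<in> Obj C; B \<in> Obj C; D \<in> Obj C; f \<in> hom_set C A B\<rbrakk>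
        \<Longrightarrow> (\<lambda>g. g \<cdot> f) \<in> hom (Hom C B D) (Hom C A D)"
    and cmp_additive_right:
      "\<lbrakk>A \<in> Obj C; B \<in> Obj C; D \<in> Obj C; g \<in> hom_set C B D\<rbrakk>
        \<Longrightarrow> (\<lambda>f. g \<cdot> f) \<in> hom (Hom C A B) (Hom C A D)"

definition is_iso :: "('o, 'm, 'z) cat_scheme \<Rightarrow> 'o \<Rightarrow> 'o \<Rightarrow> 'm \<Rightarrow> bool" where
  "is_iso C A B f \<longleftrightarrow> f \<in> hom_set C A B \<and>
     (\<exists>g \<in> hom_set C B A. g \<cdot>\<^bsub>C\<^esub> f = Ident C A \<and> f \<cdot>\<^bsub>C\<^esub> g = Ident C B)"

definition isomorphic :: "('o, 'm, 'z) cat_scheme \<Rightarrow> 'o \<Rightarrow> 'o \<Rightarrow> bool" where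
  "isomorphic C A B \<longleftrightarrow> A \<in> Obj C \<and> B \<in> Obj C \<and> (\<exists>f. is_iso C A B f)"

definition is_zero_object :: "('o, 'm, 'z) cat_scheme \<Rightarrow> 'o \<Rightarrow> bool" where
  "is_zero_object C Z \<longleftrightarrow> Z \<in> Obj C \<and>
     (\<forall>X \<in> Obj C. (\<exists>!f. f \<in> hom_set C Z X) \<and> (\<exists>!f. f \<in> hom_set C X Z))"

definition is_biproduct ::
  "('o, 'm, 'z) cat_scheme \<Rightarrow> 'o \<Rightarrow> 'o \<Rightarrow> 'o \<Rightarrow> 'm \<Rightarrow> 'm \<Rightarrow> 'm \<Rightarrow> 'm \<Rightarrow> bool" where
  "is_biproduct C A B P i j p q \<longleftrightarrow>
     A \<in> Obj C \<and> B \<in> Obj C \<and> P \<in> Obj C \<and>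
     i \<in> hom_set C A P \<and> j \<in> hom_set C B P \<and> p \<in> hom_set C P A \<and> q \<in> hom_set C P B \<and>
     p \<cdot>\<^bsub>C\<^esub> i = Ident C A \<and> q \<cdot>\<^bsub>C\<^esub> j = Ident C B \<and>
     q \<cdot>\<^bsub>C\<^esub> i = zero_mor C A B \<and> p \<cdot>\<^bsub>C\<^esub> j = zero_mor C B A \<and>
     (i \<cdot>\<^bsub>C\<^esub> p) \<otimes>\<^bsub>Hom C P P\<^esub> (j \<cdot>\<^bsub>C\<^esub> q) = Ident C P"

locale additive_category = preadditive_category +
  assumes zero_object: "\<exists>Z. is_zero_object C Z"
    and biproducts: "\<lbrakk>A \<in> Obj C; B \<in> Obj C\<rbrakk> \<Longrightarrow> \<exists>P i j p q. is_biproduct C A B P i j p q"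

definition is_kernel :: "('o, 'm, 'z) cat_scheme \<Rightarrow> 'o \<Rightarrow> 'o \<Rightarrow> 'm \<Rightarrow> 'o \<Rightarrow> 'm \<Rightarrow> bool" where
  "is_kernel C X Y f K k \<longleftrightarrow> K \<in> Obj C \<and> k \<in> hom_set C K X \<and> f \<cdot>\<^bsub>C\<^esub> k = zero_mor C K Y \<and>
     (\<forall>Z \<in> Obj C. \<forall>g \<in> hom_set C Z X. f \<cdot>\<^bsub>C\<^esub> g = zero_mor C Z Y \<longrightarrow>
        (\<exists>!h. h \<in> hom_set C Z K \<and> k \<cdot>\<^bsub>C\<^esub> h = g))"

definition is_cokernel :: "('o, 'm, 'z) cat_scheme \<Rightarrow> 'o \<Rightarrow> 'o \<Rightarrow> 'm \<Rightarrow> 'o \<Rightarrow> 'm \<Rightarrow> bool" where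
  "is_cokernel C X Y f Q q \<longleftrightarrow> Q \<in> Obj C \<and> q \<in> hom_set C Y Q \<and> q \<cdot>\<^bsub>C\<^esub> f = zero_mor C X Q \<and>
     (\<forall>Z \<in> Obj C. \<forall>g \<in> hom_set C Y Z. g \<cdot>\<^bsub>C\<^esub> f = zero_mor C X Z \<longrightarrow>
        (\<exists>!h. h \<in> hom_set C Q Z \<and> h \<cdot>\<^bsub>C\<^esub> q = g))"

definition is_mono :: "('o, 'm, 'z) cat_scheme \<Rightarrow> 'o \<Rightarrow> 'o \<Rightarrow> 'm \<Rightarrow> bool" where
  "is_mono C X Y f \<longleftrightarrow> f \<in> hom_set C X Y \<and>
     (\<forall>Z \<in> Obj C. \<forall>g \<in> hom_set C Z X. \<forall>h \<in> hom_set C Z X. f \<cdot>\<^bsub>C\<^esub> g = f \<cdot>\<^bsub>C\<^esub> h \<longrightarrow> g = h)"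

definition is_epi :: "('o, 'm, 'z) cat_scheme \<Rightarrow> 'o \<Rightarrow> 'o \<Rightarrow> 'm \<Rightarrow> bool" where
  "is_epi C X Y f \<longleftrightarrow> f \<in> hom_set C X Y \<and>
     (\<forall>Z \<in> Obj C. \<forall>g \<in> hom_set C Y Z. \<forall>h \<in> hom_set C Y Z. g \<cdot>\<^bsub>C\<^esub> f = h \<cdot>\<^bsub>C\<^esub> f \<longrightarrow> g = h)"

locale abelian_category = additive_category +
  assumes kernels:
      "\<lbrakk>X \<in> Obj C; Y \<in> Obj C; f \<in> hom_set C X Y\<rbrakk> \<Longrightarrow> \<exists>K k. is_kernel C X Y f K k"
    and cokernels:
      "\<lbrakk>X \<in> Obj C; Y \<in> Obj C; f \<in> hom_set C X Y\<rbrakk> \<Longrightarrow> \<exists>Q q. is_cokernel C X Y f Q q"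
    and mono_is_kernel:
      "\<lbrakk>X \<in> Obj C; Y \<in> Obj C; is_mono C X Y f\<rbrakk>
        \<Longrightarrow> \<exists>Z \<in> Obj C. \<exists>g \<in> hom_set C Y Z. is_kernel C Y Z g X f"
    and epi_is_cokernel:
      "\<lbrakk>X \<in> Obj C; Y \<in> Obj C; is_epi C X Y f\<rbrakk>
        \<Longrightarrow> \<exists>Z \<in> Obj C. \<exists>g \<in> hom_set C Z X. is_cokernel C Z X g Y f"

section \<open>Full subcategories and ideal quotients\<close>

text \<open>Full subcategories are given by their sets of objects.\<close>

definition full_subcat :: "('o, 'm, 'z) cat_scheme \<Rightarrow> 'o set \<Rightarrow> ('o, 'm) cat" where
  "full_subcat C D = \<lparr>Obj = D \<inter> Obj C, Hom = Hom C, Cmp = Cmp C, Ident = Ident C\<rparr>"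

definition iso_closure :: "('o, 'm, 'z) cat_scheme \<Rightarrow> 'o set \<Rightarrow> 'o set" where
  "iso_closure C D = {X \<in> Obj C. \<exists>Y \<in> D. isomorphic C X Y}"

definition dense_in :: "('o, 'm, 'z) cat_scheme \<Rightarrow> 'o set \<Rightarrow> 'o set \<Rightarrow> bool" where
  "dense_in C D' D \<longleftrightarrow> (\<forall>X \<in> D. \<exists>Y \<in> D'. isomorphic C X Y)"

definition factoring :: "('o, 'm, 'z) cat_scheme \<Rightarrow> 'o set \<Rightarrow> 'o \<Rightarrow> 'o \<Rightarrow> 'm set" where
  "factoring C W A B = {f \<in> hom_set C A B.
     \<exists>Z \<in> W \<inter> Obj C. \<exists>u \<in> hom_set C A Z. \<exists>v \<in> hom_set C Z B. f = v \<cdot>\<^bsub>C\<^esub> u}"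

text \<open>
  The morphisms of the quotient are the cosets of \<open>factoring C W A B\<close>; this set is a subgroup of
  \<open>Hom C A B\<close> as soon as \<open>W\<close> is nonempty and closed under finite direct sums. The composite of
  two cosets is the coset containing all composites of representatives.
\<close>

definition ideal_quotient :: "('o, 'm, 'z) cat_scheme \<Rightarrow> 'o set \<Rightarrow> ('o, 'm set) cat" where
  "ideal_quotient C W =
     \<lparr>Obj = Obj C,
      Hom = (\<lambda>A B. Hom C A B Mod factoring C W A B),
      Cmp = (\<lambda>G F. THE K. (\<exists>A \<in> Obj C. \<exists>B \<in> Obj C. K \<in> carrier (Hom C A B Mod factoring C W A B)) \<and>
                          (\<forall>g \<in> G. \<forall>f \<in> F. g \<cdot>\<^bsub>C\<^esub> f \<in> K)),
      Ident = (\<lambda>A. factoring C W A A #>\<^bsub>Hom C A A\<^esub> Ident C A)\<rparr>"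

section \<open>Krull--Schmidt categories\<close>

definition end_ring :: "('o, 'm, 'z) cat_scheme \<Rightarrow> 'o \<Rightarrow> 'm ring" where
  "end_ring C X = \<lparr>carrier = hom_set C X X, monoid.mult = Cmp C, one = Ident C X,
                   zero = zero_mor C X X, add = monoid.mult (Hom C X X)\<rparr>"

definition local_ring :: "('a, 'b) ring_scheme \<Rightarrow> bool" where
  "local_ring R \<longleftrightarrow> ring R \<and> \<one>\<^bsub>R\<^esub> \<noteq> \<zero>\<^bsub>R\<^esub> \<and>
     (\<forall>a \<in> carrier R - Units R. \<forall>b \<in> carrier R - Units R. a \<oplus>\<^bsub>R\<^esub> b \<notin> Units R)"

definition is_direct_sum ::
  "('o, 'm, 'z) cat_scheme \<Rightarrow> nat \<Rightarrow> (nat \<Rightarrow> 'o) \<Rightarrow> 'o \<Rightarrow> (nat \<Rightarrow> 'm) \<Rightarrow> (nat \<Rightarrow> 'm) \<Rightarrow> bool" where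
  "is_direct_sum C n Y X \<iota> \<pi> \<longleftrightarrow> X \<in> Obj C \<and>
     (\<forall>k < n. Y k \<in> Obj C \<and> \<iota> k \<in> hom_set C (Y k) X \<and> \<pi> k \<in> hom_set C X (Y k)) \<and>
     (\<forall>k < n. \<forall>l < n. \<pi> l \<cdot>\<^bsub>C\<^esub> \<iota> k = (if k = l then Ident C (Y k) else zero_mor C (Y k) (Y l))) \<and>
     (\<Otimes>\<^bsub>Hom C X X\<^esub>k\<in>{..<n}. \<iota> k \<cdot>\<^bsub>C\<^esub> \<pi> k) = Ident C X"

definition krull_schmidt :: "('o, 'm, 'z) cat_scheme \<Rightarrow> bool" where
  "krull_schmidt C \<longleftrightarrow> additive_category C \<and>
     (\<forall>X \<in> Obj C. \<exists>n Y \<iota> \<pi>. is_direct_sum C n Y X \<iota> \<pi> \<and> (\<forall>k < n. local_ring (end_ring C (Y k))))"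

section \<open>Extriangulated categories\<close>

text \<open>
  For \<open>c : C' \<rightarrow> C\<close> and \<open>a : A \<rightarrow> A'\<close>, \<open>ExtMap \<B> c a\<close> is the map \<open>\<E>(c, a) : \<E>(C, A) \<rightarrow> \<E>(C', A')\<close>.
  \<open>Realz \<B> C A \<delta>\<close> is the equivalence class assigned to \<open>\<delta> \<in> \<E>(C, A)\<close>, a set of triples
  \<open>(B, x, y)\<close> standing for sequences \<open>A \<rightarrow> B \<rightarrow> C\<close> with maps \<open>x\<close> and \<open>y\<close>.
\<close>

record ('o, 'm, 'e) extri = "('o, 'm) cat" +
  Ext :: "'o \<Rightarrow> 'o \<Rightarrow> 'e monoid"
  ExtMap :: "'m \<Rightarrow> 'm \<Rightarrow> 'e \<Rightarrow> 'e"
  Realz :: "'o \<Rightarrow> 'o \<Rightarrow> 'e \<Rightarrow> ('o \<times> 'm \<times> 'm) set"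

definition push :: "('o, 'm, 'e, 'z) extri_scheme \<Rightarrow> 'o \<Rightarrow> 'm \<Rightarrow> 'e \<Rightarrow> 'e" where
  "push \<B> C a \<delta> = ExtMap \<B> (Ident \<B> C) a \<delta>"

definition pull :: "('o, 'm, 'e, 'z) extri_scheme \<Rightarrow> 'o \<Rightarrow> 'm \<Rightarrow> 'e \<Rightarrow> 'e" where
  "pull \<B> A c \<delta> = ExtMap \<B> c (Ident \<B> A) \<delta>"

definition seqs :: "('o, 'm, 'z) cat_scheme \<Rightarrow> 'o \<Rightarrow> 'o \<Rightarrow> ('o \<times> 'm \<times> 'm) set" where
  "seqs C A D = {(B, x, y). B \<in> Obj C \<and> x \<in> hom_set C A B \<and> y \<in> hom_set C B D}"

definition seq_equiv ::
  "('o, 'm, 'z) cat_scheme \<Rightarrow> 'o \<Rightarrow> 'o \<Rightarrow> (('o \<times> 'm \<times> 'm) \<times> ('o \<times> 'm \<times> 'm)) set" where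
  "seq_equiv C A D = {((B, x, y), (B', x', y')).
     (B, x, y) \<in> seqs C A D \<and> (B', x', y') \<in> seqs C A D \<and>
     (\<exists>b. is_iso C B B' b \<and> b \<cdot>\<^bsub>C\<^esub> x = x' \<and> y' \<cdot>\<^bsub>C\<^esub> b = y)}"

definition realizes ::
  "('o, 'm, 'e, 'z) extri_scheme \<Rightarrow> 'o \<Rightarrow> 'm \<Rightarrow> 'o \<Rightarrow> 'm \<Rightarrow> 'o \<Rightarrow> 'e \<Rightarrow> bool" where
  "realizes \<B> A x B y C \<delta> \<longleftrightarrow>
     A \<in> Obj \<B> \<and> C \<in> Obj \<B> \<and> \<delta> \<in> carrier (Ext \<B> C A) \<and>
     (B, x, y) \<in> seqs \<B> A C \<and> Realz \<B> C A \<delta> = seq_equiv \<B> A C `` {(B, x, y)}"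

definition E_triangle ::
  "('o, 'm, 'e, 'z) extri_scheme \<Rightarrow> 'o \<Rightarrow> 'o \<Rightarrow> 'o \<Rightarrow> bool" where
  "E_triangle \<B> A B C \<longleftrightarrow> (\<exists>x y \<delta>. realizes \<B> A x B y C \<delta>)"

definition ET3 :: "('o, 'm, 'e, 'z) extri_scheme \<Rightarrow> bool" where
  "ET3 \<B> \<longleftrightarrow> (\<forall>A B C A' B' C' x y x' y' \<delta> \<delta>' a b.
     realizes \<B> A x B y C \<delta> \<and> realizes \<B> A' x' B' y' C' \<delta>' \<and>
     a \<in> hom_set \<B> A A' \<and> b \<in> hom_set \<B> B B' \<and> b \<cdot>\<^bsub>\<B>\<^esub> x = x' \<cdot>\<^bsub>\<B>\<^esub> a \<longrightarrow>
     (\<exists>c \<in> hom_set \<B> C C'. c \<cdot>\<^bsub>\<B>\<^esub> y = y' \<cdot>\<^bsub>\<B>\<^esub> b \<and> push \<B> C a \<delta> = pull \<B> A' c \<delta>'))"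

definition ET3_op :: "('o, 'm, 'e, 'z) extri_scheme \<Rightarrow> bool" where
  "ET3_op \<B> \<longleftrightarrow> (\<forall>A B C A' B' C' x y x' y' \<delta> \<delta>' b c.
     realizes \<B> A x B y C \<delta> \<and> realizes \<B> A' x' B' y' C' \<delta>' \<and>
     b \<in> hom_set \<B> B B' \<and> c \<in> hom_set \<B> C C' \<and> c \<cdot>\<^bsub>\<B>\<^esub> y = y' \<cdot>\<^bsub>\<B>\<^esub> b \<longrightarrow>
     (\<exists>a \<in> hom_set \<B> A A'. b \<cdot>\<^bsub>\<B>\<^esub> x = x' \<cdot>\<^bsub>\<B>\<^esub> a \<and> push \<B> C a \<delta> = pull \<B> A' c \<delta>'))"

definition ET4 :: "('o, 'm, 'e, 'z) extri_scheme \<Rightarrow> bool" where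
  "ET4 \<B> \<longleftrightarrow> (\<forall>A B C D F f f' g g' \<delta> \<delta>'.
     realizes \<B> A f B f' D \<delta> \<and> realizes \<B> B g C g' F \<delta>' \<longrightarrow>
     (\<exists>E \<in> Obj \<B>. \<exists>d \<in> hom_set \<B> D E. \<exists>e \<in> hom_set \<B> E F. \<exists>h' \<in> hom_set \<B> C E. \<exists>\<delta>''.
        realizes \<B> A (g \<cdot>\<^bsub>\<B>\<^esub> f) C h' E \<delta>'' \<and>
        h' \<cdot>\<^bsub>\<B>\<^esub> g = d \<cdot>\<^bsub>\<B>\<^esub> f' \<and> e \<cdot>\<^bsub>\<B>\<^esub> h' = g' \<and>
        realizes \<B> D d E e F (push \<B> F f' \<delta>') \<and>
        pull \<B> A d \<delta>'' = \<delta> \<and> push \<B> E f \<delta>'' = pull \<B> B e \<delta>'))"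

text \<open>
  The dual axiom: \<open>\<delta> \<in> \<E>(A, D)\<close> and \<open>\<delta>' \<in> \<E>(B, F)\<close> are realized by \<open>D \<rightarrow> B \<rightarrow> A\<close> and \<open>F \<rightarrow> C \<rightarrow> B\<close>,
  and the deflations \<open>g : C \<rightarrow> B\<close> and \<open>f : B \<rightarrow> A\<close> are composed.
\<close>

definition ET4_op :: "('o, 'm, 'e, 'z) extri_scheme \<Rightarrow> bool" where
  "ET4_op \<B> \<longleftrightarrow> (\<forall>A B C D F f f' g g' \<delta> \<delta>'.
     realizes \<B> D f' B f A \<delta> \<and> realizes \<B> F g' C g B \<delta>' \<longrightarrow>
     (\<exists>E \<in> Obj \<B>. \<exists>d \<in> hom_set \<B> E D. \<exists>e \<in> hom_set \<B> F E. \<exists>h' \<in> hom_set \<B> E C. \<exists>\<delta>''.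
        realizes \<B> E h' C (f \<cdot>\<^bsub>\<B>\<^esub> g) A \<delta>'' \<and>
        g \<cdot>\<^bsub>\<B>\<^esub> h' = f' \<cdot>\<^bsub>\<B>\<^esub> d \<and> h' \<cdot>\<^bsub>\<B>\<^esub> e = g' \<and>
        realizes \<B> F e E d D (pull \<B> F f' \<delta>') \<and>
        push \<B> A d \<delta>'' = \<delta> \<and> pull \<B> E f \<delta>'' = push \<B> B e \<delta>'))"

text \<open>
  In \<open>realz_sum\<close>, \<open>\<delta> \<oplus> \<delta>'\<close> is the element \<open>\<E>(p, i) \<delta> + \<E>(p', i') \<delta>'\<close> of \<open>\<E>(C \<oplus> C', A \<oplus> A')\<close>, where
  \<open>p, p'\<close> are the projections of \<open>C \<oplus> C'\<close> and \<open>i, i'\<close> the injections of \<open>A \<oplus> A'\<close>; it is the element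
  with components \<open>(\<delta>, 0, 0, \<delta>')\<close>.
\<close>

locale extriangulated_category = additive_category \<B>
  for \<B> :: "('o, 'm, 'e, 'z) extri_scheme" (structure) +
  assumes ext_comm_group: "\<lbrakk>C \<in> Obj \<B>; A \<in> Obj \<B>\<rbrakk> \<Longrightarrow> comm_group (Ext \<B> C A)"
    and ext_map_hom:
      "\<lbrakk>A \<in> Obj \<B>; A' \<in> Obj \<B>; C \<in> Obj \<B>; C' \<in> Obj \<B>; c \<in> hom_set \<B> C' C; a \<in> hom_set \<B> A A'\<rbrakk>
        \<Longrightarrow> ExtMap \<B> c a \<in> hom (Ext \<B> C A) (Ext \<B> C' A')"
    and ext_map_ident:
      "\<lbrakk>A \<in> Obj \<B>; C \<in> Obj \<B>; \<delta> \<in> carrier (Ext \<B> C A)\<rbrakk>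
        \<Longrightarrow> ExtMap \<B> (Ident \<B> C) (Ident \<B> A) \<delta> = \<delta>"
    and ext_map_cmp:
      "\<lbrakk>A \<in> Obj \<B>; A' \<in> Obj \<B>; A'' \<in> Obj \<B>; C \<in> Obj \<B>; C' \<in> Obj \<B>; C'' \<in> Obj \<B>;
        c \<in> hom_set \<B> C' C; c' \<in> hom_set \<B> C'' C'; a \<in> hom_set \<B> A A'; a' \<in> hom_set \<B> A' A'';
        \<delta> \<in> carrier (Ext \<B> C A)\<rbrakk>
        \<Longrightarrow> ExtMap \<B> (c \<cdot> c') (a' \<cdot> a) \<delta> = ExtMap \<B> c' a' (ExtMap \<B> c a \<delta>)"
    and ext_map_additive_left:
      "\<lbrakk>A \<in> Obj \<B>; A' \<in> Obj \<B>; C \<in> Obj \<B>; C' \<in> Obj \<B>; a \<in> hom_set \<B> A A';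
        \<delta> \<in> carrier (Ext \<B> C A)\<rbrakk>
        \<Longrightarrow> (\<lambda>c. ExtMap \<B> c a \<delta>) \<in> hom (Hom \<B> C' C) (Ext \<B> C' A')"
    and ext_map_additive_right:
      "\<lbrakk>A \<in> Obj \<B>; A' \<in> Obj \<B>; C \<in> Obj \<B>; C' \<in> Obj \<B>; c \<in> hom_set \<B> C' C;
        \<delta> \<in> carrier (Ext \<B> C A)\<rbrakk>
        \<Longrightarrow> (\<lambda>a. ExtMap \<B> c a \<delta>) \<in> hom (Hom \<B> A A') (Ext \<B> C' A')"
    and realz_exists:
      "\<lbrakk>A \<in> Obj \<B>; C \<in> Obj \<B>; \<delta> \<in> carrier (Ext \<B> C A)\<rbrakk>
        \<Longrightarrow> \<exists>x B y. realizes \<B> A x B y C \<delta>"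
    and realz_morphism:
      "\<lbrakk>realizes \<B> A x B y C \<delta>; realizes \<B> A' x' B' y' C' \<delta>';
        a \<in> hom_set \<B> A A'; c \<in> hom_set \<B> C C'; push \<B> C a \<delta> = pull \<B> A' c \<delta>'\<rbrakk>
        \<Longrightarrow> \<exists>b \<in> hom_set \<B> B B'. b \<cdot> x = x' \<cdot> a \<and> y' \<cdot> b = c \<cdot> y"
    and realz_zero:
      "is_biproduct \<B> A C P i j p q \<Longrightarrow> realizes \<B> A i P q C \<one>\<^bsub>Ext \<B> C A\<^esub>"
    and realz_sum:
      "\<lbrakk>realizes \<B> A x B y C \<delta>; realizes \<B> A' x' B' y' C' \<delta>';
        is_biproduct \<B> A A' PA iA jA pA qA;
        is_biproduct \<B> B B' PB iB jB pB qB;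
        is_biproduct \<B> C C' PC iC jC pC qC\<rbrakk>
        \<Longrightarrow> realizes \<B>
              PA ((iB \<cdot> x \<cdot> pA) \<otimes>\<^bsub>Hom \<B> PA PB\<^esub> (jB \<cdot> x' \<cdot> qA))
              PB ((iC \<cdot> y \<cdot> pB) \<otimes>\<^bsub>Hom \<B> PB PC\<^esub> (jC \<cdot> y' \<cdot> qB)) PC
              (ExtMap \<B> pC iA \<delta> \<otimes>\<^bsub>Ext \<B> PC PA\<^esub> ExtMap \<B> qC jA \<delta>')"
    and et3: "ET3 \<B>"
    and et3_op: "ET3_op \<B>"
    and et4: "ET4 \<B>"
    and et4_op: "ET4_op \<B>"

section \<open>Twin cotorsion pairs and hearts\<close>

definition subcategory :: "('o, 'm, 'z) cat_scheme \<Rightarrow> 'o set \<Rightarrow> bool" where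
  "subcategory C D \<longleftrightarrow> D \<subseteq> Obj C \<and> (\<forall>X \<in> D. \<forall>Y. isomorphic C X Y \<longrightarrow> Y \<in> D)"

definition closed_under_summands :: "('o, 'm, 'z) cat_scheme \<Rightarrow> 'o set \<Rightarrow> bool" where
  "closed_under_summands C D \<longleftrightarrow>
     (\<forall>A B P i j p q. is_biproduct C A B P i j p q \<and> P \<in> D \<longrightarrow> A \<in> D)"

definition cotorsion_pair :: "('o, 'm, 'e, 'z) extri_scheme \<Rightarrow> 'o set \<Rightarrow> 'o set \<Rightarrow> bool" where
  "cotorsion_pair \<B> U V \<longleftrightarrow>
     subcategory \<B> U \<and> subcategory \<B> V \<and> closed_under_summands \<B> U \<and> closed_under_summands \<B> V \<and>
     (\<forall>X \<in> U. \<forall>Y \<in> V. carrier (Ext \<B> X Y) = {\<one>\<^bsub>Ext \<B> X Y\<^esub>}) \<and>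
     (\<forall>B \<in> Obj \<B>. (\<exists>Y \<in> V. \<exists>X \<in> U. E_triangle \<B> Y X B) \<and> (\<exists>Y \<in> V. \<exists>X \<in> U. E_triangle \<B> B Y X))"

definition twin_cotorsion_pair ::
  "('o, 'm, 'e, 'z) extri_scheme \<Rightarrow> 'o set \<Rightarrow> 'o set \<Rightarrow> 'o set \<Rightarrow> 'o set \<Rightarrow> bool" where
  "twin_cotorsion_pair \<B> S T U V \<longleftrightarrow> cotorsion_pair \<B> S T \<and> cotorsion_pair \<B> U V \<and> S \<subseteq> U"

text \<open>
  \<open>cone_class \<B> V W\<close> consists of the \<open>X\<close> with an \<open>\<E>\<close>-triangle \<open>V \<rightarrow> W \<rightarrow> X\<close>, and \<open>cocone_class \<B> W S\<close>
  of the \<open>Y\<close> with an \<open>\<E>\<close>-triangle \<open>Y \<rightarrow> W \<rightarrow> S\<close>. A single cotorsion pair \<open>(U, V)\<close> is the case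
  \<open>(U, V), (U, V)\<close> of a twin cotorsion pair, so \<open>heart_objects \<B> S T S T\<close> and
  \<open>heart_objects \<B> U V U V\<close> give \<open>\<H>\<^sub>1\<close> and \<open>\<H>\<^sub>2\<close>.
\<close>

definition cone_class :: "('o, 'm, 'e, 'z) extri_scheme \<Rightarrow> 'o set \<Rightarrow> 'o set \<Rightarrow> 'o set" where
  "cone_class \<B> V W = {X \<in> Obj \<B>. \<exists>Y \<in> V. \<exists>M \<in> W. E_triangle \<B> Y M X}"

definition cocone_class :: "('o, 'm, 'e, 'z) extri_scheme \<Rightarrow> 'o set \<Rightarrow> 'o set \<Rightarrow> 'o set" where
  "cocone_class \<B> W S = {Y \<in> Obj \<B>. \<exists>M \<in> W. \<exists>X \<in> S. E_triangle \<B> Y M X}"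

definition heart_objects ::
  "('o, 'm, 'e, 'z) extri_scheme \<Rightarrow> 'o set \<Rightarrow> 'o set \<Rightarrow> 'o set \<Rightarrow> 'o set \<Rightarrow> 'o set" where
  "heart_objects \<B> S T U V = cone_class \<B> V (T \<inter> U) \<inter> cocone_class \<B> (T \<inter> U) S"

abbreviation single_heart_objects ::
  "('o, 'm, 'e, 'z) extri_scheme \<Rightarrow> 'o set \<Rightarrow> 'o set \<Rightarrow> 'o set" where
  "single_heart_objects \<B> U V \<equiv> heart_objects \<B> U V U V"

text \<open>
  \<open>underline \<B> W D\<close> is the image of \<open>D\<close> in \<open>\<B>/W\<close>, as an isomorphism-closed full subcategory.
\<close>

definition underline :: "('o, 'm, 'z) cat_scheme \<Rightarrow> 'o set \<Rightarrow> 'o set \<Rightarrow> 'o set" where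
  "underline C W D = iso_closure (ideal_quotient C W) D"

definition heart ::
  "('o, 'm, 'e, 'z) extri_scheme \<Rightarrow> 'o set \<Rightarrow> 'o set \<Rightarrow> 'o set \<Rightarrow> 'o set \<Rightarrow> ('o, 'm set) cat" where
  "heart \<B> S T U V = full_subcat (ideal_quotient \<B> (T \<inter> U))
                       (underline \<B> (T \<inter> U) (heart_objects \<B> S T U V))"

end

theory Submission
  imports Defs
begin

text \<open>
  Write \<open>\<W> = T \<inter> U\<close> and call a morphism negligible if it factors through \<open>\<W>\<close>. Exactness of the
  Hom and Ext sequences of an E-triangle turns each question below into the vanishing of an
  extension class.

  Two things hold for every twin cotorsion pair. The classes \<open>\<B>\<^sup>+\<close> and \<open>\<B>\<^sup>-\<close> are closed under retracts
  modulo negligible morphisms (\<open>plus_retract\<close>), so \<open>\<H>\<close> is already closed under isomorphism in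
  \<open>\<B>/\<W>\<close>, and \<open>\<B>\<^sup>+ \<subseteq> \<B>\<^sub>1\<^sup>+\<close> (\<open>plus_subset_plus1\<close>). Hence an object of \<open>\<H>\<close> lies in \<open>\<H>\<^sub>1\<close> as soon as it
  lies in \<open>\<B>\<^sub>1\<^sup>-\<close>. That class is inherited along inflations: if \<open>Y \<rightarrow> C\<close> has its cone in \<open>S\<close> and
  \<open>Y \<in> \<B>\<^sub>1\<^sup>-\<close>, then \<open>C \<in> \<B>\<^sub>1\<^sup>-\<close> (\<open>minus1_inflation\<close>).

  Now let \<open>X \<in> \<H>\<close>. Resolving the middle term of \<open>X \<rightarrow> W' \<rightarrow> S'\<close> by \<open>S\<close> gives an epimorphism \<open>\<alpha> : Y \<rightarrow> X\<close>
  of the heart with \<open>Y \<in> \<H> \<inter> \<B>\<^sub>1\<^sup>-\<close> (\<open>epi_from_minus1\<close>). If the heart is abelian, \<open>\<alpha>\<close> is the cokernel of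
  some \<open>g : A \<rightarrow> Y\<close>. On the other hand the cokernel of \<open>g\<close> can be constructed by hand: push the
  E-triangle \<open>A \<rightarrow> W \<rightarrow> S\<close> out along \<open>g\<close> to \<open>Y \<rightarrow> C \<rightarrow> S\<close> and reflect \<open>C\<close> into \<open>\<B>\<^sup>+\<close> by an inflation
  \<open>C \<rightarrow> D\<close> with cone in \<open>S\<close> (\<open>plus_reflection\<close>). Both inflations stay inside \<open>\<B>\<^sub>1\<^sup>-\<close>, so \<open>D \<in> \<H>\<^sub>1\<close>, and
  \<open>X \<cong> D\<close> because both are cokernels of \<open>g\<close> (\<open>heart_dense_first\<close>).

  The statement about \<open>\<H>\<^sub>2\<close> is the same statement in the opposite category, where the twin cotorsion
  pair becomes \<open>((V, U), (T, S))\<close> and \<open>\<H>\<^sub>2\<close> takes the place of \<open>\<H>\<^sub>1\<close>. Finally, an object isomorphic in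
  \<open>\<B>/\<W>\<close> both to one of \<open>\<H>\<^sub>1 \<subseteq> \<B>\<^sup>-\<close> and to one of \<open>\<H>\<^sub>2 \<subseteq> \<B>\<^sup>+\<close> lies in \<open>\<B>\<^sup>- \<inter> \<B>\<^sup>+ = \<H>\<close> by the closure
  property, which together with density gives the equality of subcategories.
\<close>

section \<open>Arrows in preadditive categories\<close>

text \<open>
  Membership of both ends in \<open>Obj\<close> is part of the predicate, so that the laws of a category can be
  used with facts about arrows as their only premises.
\<close>

definition arr :: "('o, 'm, 'z) cat_scheme \<Rightarrow> 'o \<Rightarrow> 'o \<Rightarrow> 'm \<Rightarrow> bool" where
  "arr C A B f \<longleftrightarrow> A \<in> Obj C \<and> B \<in> Obj C \<and> f \<in> hom_set C A B"

text \<open>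
  Subtraction, in the multiplicative notation of the hom groups.
\<close>

abbreviation diff :: "('o, 'm, 'z) cat_scheme \<Rightarrow> 'o \<Rightarrow> 'o \<Rightarrow> 'm \<Rightarrow> 'm \<Rightarrow> 'm" where
  "diff C A B f g \<equiv> f \<otimes>\<^bsub>Hom C A B\<^esub> inv\<^bsub>Hom C A B\<^esub> g"

lemma arrD:
  assumes "arr C A B f"
  shows "A \<in> Obj C" "B \<in> Obj C" "f \<in> hom_set C A B"
  using assms by (auto simp: arr_def)

context category
begin

lemma arr_ident: "A \<in> Obj C \<Longrightarrow> arr C A A (Ident C A)"
  by (simp add: arr_def ident_closed)

lemma arr_cmp: "arr C A B f \<Longrightarrow> arr C B D g \<Longrightarrow> arr C A D (g \<cdot> f)"
  using cmp_closed by (auto simp: arr_def)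

lemma ident_cmp: "arr C A B f \<Longrightarrow> Ident C B \<cdot> f = f"
  and cmp_ident: "arr C A B f \<Longrightarrow> f \<cdot> Ident C A = f"
  using cmp_ident_left cmp_ident_right by (auto simp: arr_def)

lemma assoc: "arr C A B f \<Longrightarrow> arr C B D g \<Longrightarrow> arr C D E h \<Longrightarrow> h \<cdot> g \<cdot> f = h \<cdot> (g \<cdot> f)"
  using cmp_assoc by (auto simp: arr_def)

end

context preadditive_category
begin

lemma hom_group: "A \<in> Obj C \<Longrightarrow> B \<in> Obj C \<Longrightarrow> group (Hom C A B)"
  using hom_comm_group by (simp add: comm_group.axioms(2))

lemma arr_zero: "A \<in> Obj C \<Longrightarrow> B \<in> Obj C \<Longrightarrow> arr C A B (zero_mor C A B)"
  by (simp add: arr_def hom_group group.is_monoid)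

lemma arr_add: "arr C A B f \<Longrightarrow> arr C A B g \<Longrightarrow> arr C A B (f \<otimes>\<^bsub>Hom C A B\<^esub> g)"
  by (simp add: arr_def hom_group group.is_monoid monoid.m_closed)

lemma arr_neg: "arr C A B f \<Longrightarrow> arr C A B (inv\<^bsub>Hom C A B\<^esub> f)"
  by (simp add: arr_def hom_group)

lemma arr_diff: "arr C A B f \<Longrightarrow> arr C A B g \<Longrightarrow> arr C A B (diff C A B f g)"
  by (simp add: arr_add arr_neg)

lemma add_cmp:
  "arr C A B f \<Longrightarrow> arr C B D g \<Longrightarrow> arr C B D h \<Longrightarrow>
    (g \<otimes>\<^bsub>Hom C B D\<^esub> h) \<cdot> f = (g \<cdot> f) \<otimes>\<^bsub>Hom C A D\<^esub> (h \<cdot> f)"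
  using cmp_additive_left[of A B D f] by (auto simp: arr_def hom_def)

lemma cmp_add:
  "arr C A B f \<Longrightarrow> arr C A B g \<Longrightarrow> arr C B D h \<Longrightarrow>
    h \<cdot> (f \<otimes>\<^bsub>Hom C A B\<^esub> g) = (h \<cdot> f) \<otimes>\<^bsub>Hom C A D\<^esub> (h \<cdot> g)"
  using cmp_additive_right[of A B D h] by (auto simp: arr_def hom_def)

lemma zero_cmp: "arr C A B f \<Longrightarrow> D \<in> Obj C \<Longrightarrow> zero_mor C B D \<cdot> f = zero_mor C A D"
  using cmp_additive_left[of A B D f] hom_one[OF _ hom_group hom_group, of "\<lambda>g. g \<cdot> f" B D A D]
  by (auto simp: arr_def)

lemma neg_cmp:
  assumes "arr C A B f" "arr C B D g"
  shows "inv\<^bsub>Hom C B D\<^esub> g \<cdot> f = inv\<^bsub>Hom C A D\<^esub> (g \<cdot> f)"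
proof -
  interpret group_hom "Hom C B D" "Hom C A D" "\<lambda>g. g \<cdot> f"
    using assms cmp_additive_left
    by (auto simp: arr_def group_hom_def group_hom_axioms_def hom_group)
  show ?thesis using assms by (simp add: arr_def)
qed

lemma cmp_neg:
  assumes "arr C A B f" "arr C B D g"
  shows "g \<cdot> inv\<^bsub>Hom C A B\<^esub> f = inv\<^bsub>Hom C A D\<^esub> (g \<cdot> f)"
proof -
  interpret group_hom "Hom C A B" "Hom C A D" "\<lambda>f. g \<cdot> f"
    using assms cmp_additive_right
    by (auto simp: arr_def group_hom_def group_hom_axioms_def hom_group)
  show ?thesis using assms by (simp add: arr_def)
qed

lemma diff_cmp:
  "arr C A B f \<Longrightarrow> arr C B D g \<Longrightarrow> arr C B D h \<Longrightarrow>
    diff C B D g h \<cdot> f = diff C A D (g \<cdot> f) (h \<cdot> f)"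
  by (simp add: add_cmp arr_neg neg_cmp)

lemma cmp_diff:
  "arr C A B f \<Longrightarrow> arr C A B g \<Longrightarrow> arr C B D h \<Longrightarrow>
    h \<cdot> diff C A B f g = diff C A D (h \<cdot> f) (h \<cdot> g)"
  by (simp add: cmp_add arr_neg cmp_neg)

lemma add_zero:
  assumes "arr C A B f"
  shows "f \<otimes>\<^bsub>Hom C A B\<^esub> zero_mor C A B = f" "zero_mor C A B \<otimes>\<^bsub>Hom C A B\<^esub> f = f"
  using assms by (simp_all add: arr_def hom_group group.is_monoid)

lemma diff_add:
  assumes "arr C A B f" "arr C A B g"
  shows "diff C A B f g \<otimes>\<^bsub>Hom C A B\<^esub> g = f" "g \<otimes>\<^bsub>Hom C A B\<^esub> diff C A B f g = f"
proof -
  interpret comm_group "Hom C A B" using assms hom_comm_group by (simp add: arr_def)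
  show "diff C A B f g \<otimes>\<^bsub>Hom C A B\<^esub> g = f" "g \<otimes>\<^bsub>Hom C A B\<^esub> diff C A B f g = f"
    using assms by (simp_all add: arr_def m_assoc m_lcomm)
qed

lemma diff_self: "arr C A B f \<Longrightarrow> diff C A B f f = zero_mor C A B"
  by (simp add: arr_def hom_group group.r_inv)

lemma is_biproduct_swap:
  assumes "is_biproduct C A B P i j p q"
  shows "is_biproduct C B A P j i q p"
proof -
  have b: "arr C A P i" "arr C B P j" "arr C P A p" "arr C P B q"
    using assms by (auto simp: is_biproduct_def arr_def)
  then interpret comm_group "Hom C P P" using hom_comm_group by (simp add: arr_def)
  have "i \<cdot> p \<in> hom_set C P P" "j \<cdot> q \<in> hom_set C P P"
    using arrD(3)[OF arr_cmp[OF b(3,1)]] arrD(3)[OF arr_cmp[OF b(4,2)]] by auto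
  then have "(j \<cdot> q) \<otimes>\<^bsub>Hom C P P\<^esub> (i \<cdot> p) = (i \<cdot> p) \<otimes>\<^bsub>Hom C P P\<^esub> (j \<cdot> q)"
    by (rule m_comm[symmetric])
  then show ?thesis using assms by (simp add: is_biproduct_def)
qed

end

section \<open>The opposite of an extriangulated category\<close>

text \<open>
  The bifunctor keeps its values, with the two arguments exchanged, and a realizing sequence is
  read backwards; composition order and the roles of \<open>push\<close> and \<open>pull\<close> swap accordingly.
\<close>

definition opp :: "('o, 'm, 'e, 'z) extri_scheme \<Rightarrow> ('o, 'm, 'e) extri" where
  "opp \<B> = \<lparr>Obj = Obj \<B>, Hom = (\<lambda>A B. Hom \<B> B A), Cmp = (\<lambda>g f. f \<cdot>\<^bsub>\<B>\<^esub> g), Ident = Ident \<B>,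
     Ext = (\<lambda>C A. Ext \<B> A C), ExtMap = (\<lambda>c a. ExtMap \<B> a c),
     Realz = (\<lambda>C A \<delta>. {(B, y, x). (B, x, y) \<in> Realz \<B> A C \<delta>})\<rparr>"

lemma opp_simps [simp]:
  "Obj (opp \<B>) = Obj \<B>" "Hom (opp \<B>) A B = Hom \<B> B A" "g \<cdot>\<^bsub>opp \<B>\<^esub> f = f \<cdot>\<^bsub>\<B>\<^esub> g"
  "Ident (opp \<B>) = Ident \<B>" "Ext (opp \<B>) C A = Ext \<B> A C" "ExtMap (opp \<B>) c a = ExtMap \<B> a c"
  "Realz (opp \<B>) C A \<delta> = {(B, y, x). (B, x, y) \<in> Realz \<B> A C \<delta>}"
  "push (opp \<B>) C a \<delta> = pull \<B> C a \<delta>" "pull (opp \<B>) C a \<delta> = push \<B> C a \<delta>"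
  by (simp_all add: opp_def push_def pull_def)

lemma is_biproduct_opp [simp]:
  "is_biproduct (opp \<B>) A B P i j p q \<longleftrightarrow> is_biproduct \<B> A B P p q i j"
  by (auto simp: is_biproduct_def)

lemma is_zero_object_opp [simp]: "is_zero_object (opp \<B>) Z \<longleftrightarrow> is_zero_object \<B> Z"
  by (auto simp: is_zero_object_def)

lemma is_iso_opp [simp]: "is_iso (opp \<B>) A B f \<longleftrightarrow> is_iso \<B> B A f"
  by (auto simp: is_iso_def)

lemma is_iso_inverse:
  assumes "is_iso C A B f"
  obtains g where "is_iso C B A g" "g \<cdot>\<^bsub>C\<^esub> f = Ident C A" "f \<cdot>\<^bsub>C\<^esub> g = Ident C B"
  using assms unfolding is_iso_def by blast

lemma isomorphic_sym: "isomorphic C A B \<Longrightarrow> isomorphic C B A"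
  by (auto simp: isomorphic_def elim: is_iso_inverse)

lemma isomorphic_opp [simp]: "isomorphic (opp \<B>) A B \<longleftrightarrow> isomorphic \<B> A B"
  using isomorphic_sym[of \<B> A B] isomorphic_sym[of \<B> B A] by (auto simp: isomorphic_def)

lemma subcategory_opp [simp]: "subcategory (opp \<B>) D \<longleftrightarrow> subcategory \<B> D"
  by (simp add: subcategory_def)

lemma closed_under_summands_opp [simp]:
  "closed_under_summands (opp \<B>) D \<longleftrightarrow> closed_under_summands \<B> D"
  by (auto simp: closed_under_summands_def) blast+

lemma factoring_opp [simp]: "factoring (opp \<B>) W A B = factoring \<B> W B A"
  by (auto simp: factoring_def)

lemma arr_opp [simp]: "arr (opp \<B>) A B f \<longleftrightarrow> arr \<B> B A f"
  by (auto simp: arr_def)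

text \<open>
  An equivalence of sequences can be witnessed by the inverse isomorphism. In the opposite category
  an isomorphism of middle terms changes direction, so this form is what the dual relation becomes.
\<close>

lemma (in category) seq_equiv_iff_reverse:
  assumes "A \<in> Obj C" "D \<in> Obj C"
  shows "((B, x, y), (B', x', y')) \<in> seq_equiv C A D \<longleftrightarrow>
    (\<exists>b. B \<in> Obj C \<and> B' \<in> Obj C \<and> x \<in> hom_set C A B \<and> y \<in> hom_set C B D \<and>
     x' \<in> hom_set C A B' \<and> y' \<in> hom_set C B' D \<and> is_iso C B' B b \<and> b \<cdot> x' = x \<and> y \<cdot> b = y')"
proof -
  have *: "\<exists>c. is_iso C B' B c \<and> c \<cdot> x' = x \<and> y \<cdot> c = y'"
    if h: "is_iso C B B' b" "b \<cdot> x = x'" "y' \<cdot> b = y" "B \<in> Obj C" "B' \<in> Obj C" "x \<in> hom_set C A B"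
      "y' \<in> hom_set C B' D"
    for B x y B' x' y' b
  proof -
    obtain c where c: "is_iso C B' B c" "c \<cdot> b = Ident C B" "b \<cdot> c = Ident C B'"
      using is_iso_inverse[OF h(1)] .
    have m: "b \<in> hom_set C B B'" "c \<in> hom_set C B' B" using h(1) c(1) by (auto simp: is_iso_def)
    have "c \<cdot> x' = (c \<cdot> b) \<cdot> x" using cmp_assoc[OF assms(1) h(4,5,4,6) m] h(2) by simp
    moreover have "y \<cdot> c = y' \<cdot> (b \<cdot> c)" using cmp_assoc[OF h(5,4,5) assms(2) m(2,1) h(7)] h(3) by simp
    ultimately show ?thesis using c h assms by (auto simp: cmp_ident_left cmp_ident_right)
  qed
  show ?thesis
    unfolding seq_equiv_def seqs_def using *[of B B' _ x x' y' y] *[of B' B _ x' x y y'] by auto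
qed

context extriangulated_category
begin

lemma seq_equiv_opp_iff:
  assumes "A \<in> Obj \<B>" "C \<in> Obj \<B>"
  shows "((B, y, x), (B', y', x')) \<in> seq_equiv (opp \<B>) C A \<longleftrightarrow>
    ((B, x, y), (B', x', y')) \<in> seq_equiv \<B> A C"
  unfolding seq_equiv_iff_reverse[OF assms]
  by (auto simp: seq_equiv_def seqs_def)

lemma realizes_opp: "realizes (opp \<B>) A x B y C \<delta> \<longleftrightarrow> realizes \<B> C y B x A \<delta>"
proof (cases "A \<in> Obj \<B> \<and> C \<in> Obj \<B>")
  case True
  have 1: "seq_equiv (opp \<B>) A C `` {(B, x, y)} =
      {(B', x', y'). (B', y', x') \<in> seq_equiv \<B> C A `` {(B, y, x)}}"
    using True by (auto simp: seq_equiv_opp_iff)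
  have 2: "{(B, y, x). (B, x, y) \<in> R} = {(B, y, x). (B, x, y) \<in> R'} \<longleftrightarrow> R = R'"
    for R R' :: "('p \<times> 'q \<times> 'q) set"
    by (auto simp: set_eq_iff)
  have 3: "(B, x, y) \<in> seqs (opp \<B>) A C \<longleftrightarrow> (B, y, x) \<in> seqs \<B> C A"
    by (auto simp: seqs_def)
  show ?thesis unfolding realizes_def opp_simps 1 2 3
    by (rule iffI; elim conjE; intro conjI; assumption)
qed (auto simp: realizes_def)

lemma et3D:
  assumes "realizes \<B> A x B y C \<delta>" "realizes \<B> A' x' B' y' C' \<delta>'"
    "a \<in> hom_set \<B> A A'" "b \<in> hom_set \<B> B B'" "b \<cdot> x = x' \<cdot> a"
  shows "\<exists>c \<in> hom_set \<B> C C'. c \<cdot> y = y' \<cdot> b \<and> push \<B> C a \<delta> = pull \<B> A' c \<delta>'"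
  using et3[unfolded ET3_def] assms by blast

lemma et3_opD:
  assumes "realizes \<B> A x B y C \<delta>" "realizes \<B> A' x' B' y' C' \<delta>'"
    "b \<in> hom_set \<B> B B'" "c \<in> hom_set \<B> C C'" "c \<cdot> y = y' \<cdot> b"
  shows "\<exists>a \<in> hom_set \<B> A A'. b \<cdot> x = x' \<cdot> a \<and> push \<B> C a \<delta> = pull \<B> A' c \<delta>'"
  using et3_op[unfolded ET3_op_def] assms by blast

lemma ET3_opp: "ET3 (opp \<B>)"
proof -
  have "\<exists>c \<in> hom_set \<B> C' C. y \<cdot> c = b \<cdot> y' \<and> pull \<B> C a \<delta> = push \<B> A' c \<delta>'"
    if "realizes \<B> C y B x A \<delta>" "realizes \<B> C' y' B' x' A' \<delta>'"
      "a \<in> hom_set \<B> A' A" "b \<in> hom_set \<B> B' B" "x \<cdot> b = a \<cdot> x'"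
    for A B C A' B' C' x y x' y' \<delta> \<delta>' a b
    using et3_opD[OF that(2,1,4,3)] that(5) by metis
  then show ?thesis unfolding ET3_def realizes_opp opp_simps
    by (intro allI impI; elim conjE)
qed

lemma ET3_op_opp: "ET3_op (opp \<B>)"
proof -
  have "\<exists>a \<in> hom_set \<B> A' A. x \<cdot> b = a \<cdot> x' \<and> pull \<B> C a \<delta> = push \<B> A' c \<delta>'"
    if "realizes \<B> C y B x A \<delta>" "realizes \<B> C' y' B' x' A' \<delta>'"
      "b \<in> hom_set \<B> B' B" "c \<in> hom_set \<B> C' C" "y \<cdot> c = b \<cdot> y'"
    for A B C A' B' C' x y x' y' \<delta> \<delta>' b c
    using et3D[OF that(2,1,4,3)] that(5) by metis
  then show ?thesis unfolding ET3_op_def realizes_opp opp_simps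
    by (intro allI impI; elim conjE)
qed

lemma ET4_opp: "ET4 (opp \<B>)"
  using et4_op by (simp add: ET4_def ET4_op_def realizes_opp)

lemma ET4_op_opp: "ET4_op (opp \<B>)"
  using et4 by (simp add: ET4_def ET4_op_def realizes_opp)

text \<open>
  The axioms come in dual pairs: (ET3), (ET4) are exchanged with their duals, and the rest is
  self-dual. From here on, every lemma has its dual by instantiation at \<open>opp \<B>\<close>.
\<close>

theorem opp_extriangulated: "extriangulated_category (opp \<B>)"
proof (intro extriangulated_category.intro additive_category.intro preadditive_category.intro
    category.intro preadditive_category_axioms.intro additive_category_axioms.intro
    extriangulated_category_axioms.intro, goal_cases)
  case 1 then show ?case using hom_disjoint by simp
next
  case 2 then show ?case using ident_closed by simp
next
  case 3 then show ?case using cmp_closed by simp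
next
  case 4 then show ?case using cmp_ident_right by simp
next
  case 5 then show ?case using cmp_ident_left by simp
next
  case 6 then show ?case using cmp_assoc by simp
next
  case 7 then show ?case using hom_comm_group by simp
next
  case 8 then show ?case using cmp_additive_right by simp
next
  case 9 then show ?case using cmp_additive_left by simp
next
  case 10 then show ?case using zero_object by simp
next
  case (11 A B) then show ?case using biproducts by simp blast
next
  case 12 then show ?case using ext_comm_group by simp
next
  case 13 then show ?case using ext_map_hom by simp
next
  case 14 then show ?case using ext_map_ident by simp
next
  case (15 A A' A'' C C' C'' c c' a a' \<delta>)
  then show ?case using ext_map_cmp[of C C' C'' A A' A'' a a' c c' \<delta>] by simp
next
  case 16 then show ?case using ext_map_additive_right by simp
next
  case 17 then show ?case using ext_map_additive_left by simp
next
  case 18 then show ?case using realz_exists by (simp add: realizes_opp) blast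
next
  case 19 then show ?case using realz_morphism by (simp add: realizes_opp) metis
next
  case (20 A C P i j p q)
  then show ?case using realz_zero[OF is_biproduct_swap, of A C P p q i j] by (simp add: realizes_opp)
next
  case (21 A x B y C \<delta> A' x' B' y' C' \<delta>' PA iA jA pA qA PB iB jB pB qB PC iC jC pC qC)
  then have b: "is_biproduct \<B> A A' PA pA qA iA jA" "is_biproduct \<B> B B' PB pB qB iB jB"
      "is_biproduct \<B> C C' PC pC qC iC jC"
    and r: "realizes \<B> C y B x A \<delta>" "realizes \<B> C' y' B' x' A' \<delta>'"
    by (simp_all add: realizes_opp)
  have a: "arr \<B> A PA pA" "arr \<B> A' PA qA" "arr \<B> B PB pB" "arr \<B> B' PB qB"
      "arr \<B> PB B iB" "arr \<B> PB B' jB" "arr \<B> PC C iC" "arr \<B> PC C' jC"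
      "arr \<B> B A x" "arr \<B> B' A' x'" "arr \<B> C B y" "arr \<B> C' B' y'"
    using b r by (auto simp: is_biproduct_def realizes_def seqs_def arr_def)
  have "pB \<cdot> (y \<cdot> iC) = pB \<cdot> y \<cdot> iC" "qB \<cdot> (y' \<cdot> jC) = qB \<cdot> y' \<cdot> jC"
      "pA \<cdot> (x \<cdot> iB) = pA \<cdot> x \<cdot> iB" "qA \<cdot> (x' \<cdot> jB) = qA \<cdot> x' \<cdot> jB"
    using a by (metis assoc)+
  then show ?case using realz_sum[OF r b(3,2,1)] by (simp add: realizes_opp)
next
  case 22 show ?case by (rule ET3_opp)
next
  case 23 show ?case by (rule ET3_op_opp)
next
  case 24 show ?case by (rule ET4_opp)
next
  case 25 show ?case by (rule ET4_op_opp)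
qed

end

section \<open>Exact sequences of an E-triangle\<close>

context preadditive_category
begin

lemma zero_object_arr_eq:
  assumes "is_zero_object C Z"
  shows "arr C Z A f \<Longrightarrow> arr C Z A g \<Longrightarrow> f = g" "arr C A Z f \<Longrightarrow> arr C A Z g \<Longrightarrow> f = g"
  using assms by (auto simp: is_zero_object_def arr_def)

lemma is_biproduct_zero:
  assumes Z: "is_zero_object C Z" and A: "A \<in> Obj C"
  shows "is_biproduct C A Z A (Ident C A) (zero_mor C Z A) (Ident C A) (zero_mor C A Z)"
    and "is_biproduct C Z A A (zero_mor C Z A) (Ident C A) (zero_mor C A Z) (Ident C A)"
proof -
  have Z': "Z \<in> Obj C" using Z by (simp add: is_zero_object_def)
  note o = A Z'
  note a = arr_zero[OF o] arr_zero[OF o(2,1)] arr_ident[OF A] arr_ident[OF Z']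
  have 1: "zero_mor C A Z \<cdot> zero_mor C Z A = Ident C Z"
    using zero_object_arr_eq(1)[OF Z] arr_cmp a by blast
  have 2: "zero_mor C Z A \<cdot> zero_mor C A Z = zero_mor C A A" using a A by (simp add: zero_cmp)
  show "is_biproduct C A Z A (Ident C A) (zero_mor C Z A) (Ident C A) (zero_mor C A Z)"
    "is_biproduct C Z A A (zero_mor C Z A) (Ident C A) (zero_mor C A Z) (Ident C A)"
    unfolding is_biproduct_def
    using 1 2 a arrD(3)[OF a(1)] arrD(3)[OF a(2)] arrD(3)[OF a(3)] A Z'
    by (simp_all add: ident_cmp[OF a(1)] ident_cmp[OF a(2)] ident_cmp[OF a(3)]
        cmp_ident[OF a(1)] cmp_ident[OF a(2)] cmp_ident[OF a(3)] add_zero)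
qed

end

context extriangulated_category
begin

lemma realizesD:
  assumes "realizes \<B> A x B y C \<delta>"
  shows "arr \<B> A B x" "arr \<B> B C y" "\<delta> \<in> carrier (Ext \<B> C A)" "A \<in> Obj \<B>" "B \<in> Obj \<B>" "C \<in> Obj \<B>"
  using assms by (auto simp: realizes_def seqs_def arr_def)

lemma ext_group: "C \<in> Obj \<B> \<Longrightarrow> A \<in> Obj \<B> \<Longrightarrow> group (Ext \<B> C A)"
  using ext_comm_group by (simp add: comm_group.axioms(2))

lemma ext_one_closed: "C \<in> Obj \<B> \<Longrightarrow> A \<in> Obj \<B> \<Longrightarrow> \<one>\<^bsub>Ext \<B> C A\<^esub> \<in> carrier (Ext \<B> C A)"
  by (simp add: ext_group group.is_monoid)

lemma push_hom: "arr \<B> A A' a \<Longrightarrow> C \<in> Obj \<B> \<Longrightarrow> push \<B> C a \<in> hom (Ext \<B> C A) (Ext \<B> C A')"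
  using ext_map_hom[of A A' C C "Ident \<B> C" a]
  by (simp add: push_def[abs_def] arr_def ident_closed)

lemma push_closed:
  "arr \<B> A A' a \<Longrightarrow> C \<in> Obj \<B> \<Longrightarrow> \<delta> \<in> carrier (Ext \<B> C A) \<Longrightarrow> push \<B> C a \<delta> \<in> carrier (Ext \<B> C A')"
  using push_hom by (blast dest: hom_in_carrier)

lemma push_one: "arr \<B> A A' a \<Longrightarrow> C \<in> Obj \<B> \<Longrightarrow> push \<B> C a \<one>\<^bsub>Ext \<B> C A\<^esub> = \<one>\<^bsub>Ext \<B> C A'\<^esub>"
  using hom_one[OF push_hom] by (simp add: ext_group arr_def)

lemma push_ident: "A \<in> Obj \<B> \<Longrightarrow> C \<in> Obj \<B> \<Longrightarrow> \<delta> \<in> carrier (Ext \<B> C A) \<Longrightarrow> push \<B> C (Ident \<B> A) \<delta> = \<delta>"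
  by (simp add: push_def ext_map_ident)

lemma push_cmp:
  "arr \<B> A A' a \<Longrightarrow> arr \<B> A' A'' a' \<Longrightarrow> C \<in> Obj \<B> \<Longrightarrow> \<delta> \<in> carrier (Ext \<B> C A) \<Longrightarrow>
    push \<B> C (a' \<cdot> a) \<delta> = push \<B> C a' (push \<B> C a \<delta>)"
  using ext_map_cmp[of A A' A'' C C C "Ident \<B> C" "Ident \<B> C" a a' \<delta>]
  by (simp add: push_def arr_def ident_closed cmp_ident_left[OF _ _ ident_closed])

lemma push_pull:
  assumes "arr \<B> A A' a" "arr \<B> C' C c" "\<delta> \<in> carrier (Ext \<B> C A)"
  shows "push \<B> C' a (pull \<B> A c \<delta>) = pull \<B> A' c (push \<B> C a \<delta>)"
  using assms ext_map_cmp[of A A A' C C' C' c "Ident \<B> C'" "Ident \<B> A" a \<delta>]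
    ext_map_cmp[of A A' A' C C C' "Ident \<B> C" c a "Ident \<B> A'" \<delta>]
  ident_cmp[OF assms(1)] cmp_ident[OF assms(1)] ident_cmp[OF assms(2)] cmp_ident[OF assms(2)]
  by (simp add: push_def pull_def arr_def ident_closed)

lemma push_zero:
  assumes "A \<in> Obj \<B>" "A' \<in> Obj \<B>" "C \<in> Obj \<B>" "\<delta> \<in> carrier (Ext \<B> C A)"
  shows "push \<B> C (zero_mor \<B> A A') \<delta> = \<one>\<^bsub>Ext \<B> C A'\<^esub>"
  using hom_one[OF ext_map_additive_right[of A A' C C "Ident \<B> C" \<delta>]] assms
  by (simp add: push_def hom_group ext_group ident_closed)

lemma push_add:
  assumes "arr \<B> A A' a" "arr \<B> A A' a'" "C \<in> Obj \<B>" "\<delta> \<in> carrier (Ext \<B> C A)"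
  shows "push \<B> C (a \<otimes>\<^bsub>Hom \<B> A A'\<^esub> a') \<delta> = push \<B> C a \<delta> \<otimes>\<^bsub>Ext \<B> C A'\<^esub> push \<B> C a' \<delta>"
  using hom_mult[OF ext_map_additive_right[of A A' C C "Ident \<B> C" \<delta>]] assms
  by (simp add: push_def arr_def ident_closed)

text \<open>The statements about \<open>pull\<close> are those about \<open>push\<close> in the opposite category.\<close>

lemma pull_closed:
  "arr \<B> C' C c \<Longrightarrow> A \<in> Obj \<B> \<Longrightarrow> \<delta> \<in> carrier (Ext \<B> C A) \<Longrightarrow> pull \<B> A c \<delta> \<in> carrier (Ext \<B> C' A)"
  using extriangulated_category.push_closed[OF opp_extriangulated] by simp

lemma pull_one: "arr \<B> C' C c \<Longrightarrow> A \<in> Obj \<B> \<Longrightarrow> pull \<B> A c \<one>\<^bsub>Ext \<B> C A\<^esub> = \<one>\<^bsub>Ext \<B> C' A\<^esub>"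
  using extriangulated_category.push_one[OF opp_extriangulated] by simp

lemma pull_cmp:
  "arr \<B> C' C c \<Longrightarrow> arr \<B> C'' C' c' \<Longrightarrow> A \<in> Obj \<B> \<Longrightarrow> \<delta> \<in> carrier (Ext \<B> C A) \<Longrightarrow>
    pull \<B> A (c \<cdot> c') \<delta> = pull \<B> A c' (pull \<B> A c \<delta>)"
  using extriangulated_category.push_cmp[OF opp_extriangulated] by simp

text \<open>
  Comparing a triangle with these two through (ET3) and the realization axiom yields the
  exactness of the Hom sequences below and their connection to \<open>\<E>\<close>.
\<close>

lemma realizes_ident_zero:
  assumes "is_zero_object \<B> Z" "A \<in> Obj \<B>"
  shows "realizes \<B> A (Ident \<B> A) A (zero_mor \<B> A Z) Z \<one>\<^bsub>Ext \<B> Z A\<^esub>"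
    "realizes \<B> Z (zero_mor \<B> Z A) A (Ident \<B> A) A \<one>\<^bsub>Ext \<B> A Z\<^esub>"
  using is_biproduct_zero[OF assms] realz_zero by blast+

lemma push_inflation:
  assumes r: "realizes \<B> A x B y C \<delta>"
  shows "push \<B> C x \<delta> = \<one>\<^bsub>Ext \<B> C B\<^esub>"
proof -
  note d = realizesD[OF r]
  obtain Z where Z: "is_zero_object \<B> Z" using zero_object by blast
  then have Z': "Z \<in> Obj \<B>" by (simp add: is_zero_object_def)
  obtain c where c: "c \<in> hom_set \<B> C Z" "push \<B> C x \<delta> = pull \<B> B c \<one>\<^bsub>Ext \<B> Z B\<^esub>"
    using et3D[OF r realizes_ident_zero(1)[OF Z d(5)] arrD(3)[OF d(1)] arrD(3)[OF arr_ident[OF d(5)]]]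
    by blast
  have "arr \<B> C Z c" using c Z' d by (simp add: arr_def)
  then show ?thesis using c(2) d pull_one by simp
qed

text \<open>
  Exactness of \<open>Hom(B, Z) \<rightarrow> Hom(A, Z) \<rightarrow> \<E>(C, Z)\<close>. A vanishing class \<open>h\<^sub>* \<delta>\<close> makes \<open>(h, 0)\<close> a morphism
  from \<open>\<delta>\<close> to the zero class in \<open>\<E>(0, Z)\<close>, which is realized by \<open>Z \<rightarrow> Z \<rightarrow> 0\<close>; its middle component
  is the extension.
\<close>

lemma extends_iff_push:
  assumes r: "realizes \<B> A x B y C \<delta>" and h: "arr \<B> A Z h"
  shows "(\<exists>k. arr \<B> B Z k \<and> k \<cdot> x = h) \<longleftrightarrow> push \<B> C h \<delta> = \<one>\<^bsub>Ext \<B> C Z\<^esub>"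
proof
  note d = realizesD[OF r]
  show "push \<B> C h \<delta> = \<one>\<^bsub>Ext \<B> C Z\<^esub>" if "\<exists>k. arr \<B> B Z k \<and> k \<cdot> x = h"
    using that push_cmp[OF d(1) _ d(6,3)] push_inflation[OF r] push_one d(6) by metis
  assume 0: "push \<B> C h \<delta> = \<one>\<^bsub>Ext \<B> C Z\<^esub>"
  obtain N where N: "is_zero_object \<B> N" using zero_object by blast
  then have N': "N \<in> Obj \<B>" by (simp add: is_zero_object_def)
  note z = arr_zero[OF d(6) N']
  have "push \<B> C h \<delta> = pull \<B> Z (zero_mor \<B> C N) \<one>\<^bsub>Ext \<B> N Z\<^esub>"
    using 0 pull_one[OF z arrD(2)[OF h]] by simp
  then obtain b where "b \<in> hom_set \<B> B Z" "b \<cdot> x = Ident \<B> Z \<cdot> h"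
    using realz_morphism[OF r realizes_ident_zero(1)[OF N arrD(2)[OF h]] arrD(3)[OF h] arrD(3)[OF z]]
    by blast
  then show "\<exists>k. arr \<B> B Z k \<and> k \<cdot> x = h" using d h ident_cmp[OF h] by (auto simp: arr_def)
qed

text \<open>
  Exactness of \<open>Hom(C, Z) \<rightarrow> Hom(B, Z) \<rightarrow> Hom(A, Z)\<close>: apply (ET3) to the map from the triangle to
  \<open>0 \<rightarrow> Z \<rightarrow> Z\<close>.
\<close>

lemma factors_through_deflation:
  assumes r: "realizes \<B> A x B y C \<delta>" and h: "arr \<B> B Z h" and 0: "h \<cdot> x = zero_mor \<B> A Z"
  shows "\<exists>k. arr \<B> C Z k \<and> k \<cdot> y = h"
proof -
  note d = realizesD[OF r]
  obtain N where N: "is_zero_object \<B> N" using zero_object by blast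
  then have N': "N \<in> Obj \<B>" by (simp add: is_zero_object_def)
  note z = arr_zero[OF d(4) N'] and z' = arr_zero[OF N' arrD(2)[OF h]]
  have "h \<cdot> x = zero_mor \<B> N Z \<cdot> zero_mor \<B> A N" using 0 zero_cmp[OF z arrD(2)[OF h]] by simp
  then obtain c where "c \<in> hom_set \<B> C Z" "c \<cdot> y = Ident \<B> Z \<cdot> h"
    using et3D[OF r realizes_ident_zero(2)[OF N arrD(2)[OF h]] arrD(3)[OF z] arrD(3)[OF h]] by blast
  then show ?thesis using d h ident_cmp[OF h] by (auto simp: arr_def)
qed

lemma factors_through_inflation:
  assumes "realizes \<B> A x B y C \<delta>" "arr \<B> Z B h" "y \<cdot> h = zero_mor \<B> Z C"
  shows "\<exists>k. arr \<B> Z A k \<and> x \<cdot> k = h"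
  using extriangulated_category.factors_through_deflation[OF opp_extriangulated, of C y B x A \<delta> Z h] assms
  by (simp add: realizes_opp)

lemma ET4D:
  assumes "realizes \<B> A f B f' D \<delta>" "realizes \<B> B g C g' F \<delta>'"
  obtains E d e h' \<delta>'' where "arr \<B> D E d" "arr \<B> E F e" "arr \<B> C E h'"
    "realizes \<B> A (g \<cdot> f) C h' E \<delta>''" "h' \<cdot> g = d \<cdot> f'" "e \<cdot> h' = g'"
    "realizes \<B> D d E e F (push \<B> F f' \<delta>')" "pull \<B> A d \<delta>'' = \<delta>" "push \<B> E f \<delta>'' = pull \<B> B e \<delta>'"
proof -
  obtain E d e h' \<delta>'' where *: "E \<in> Obj \<B>" "d \<in> hom_set \<B> D E" "e \<in> hom_set \<B> E F" "h' \<in> hom_set \<B> C E"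
    "realizes \<B> A (g \<cdot> f) C h' E \<delta>''" "h' \<cdot> g = d \<cdot> f'" "e \<cdot> h' = g'"
    "realizes \<B> D d E e F (push \<B> F f' \<delta>')" "pull \<B> A d \<delta>'' = \<delta>" "push \<B> E f \<delta>'' = pull \<B> B e \<delta>'"
    using et4[unfolded ET4_def, rule_format, OF conjI[OF assms]] by blast
  show ?thesis using that[OF _ _ _ *(5-10)] realizesD[OF *(5)] realizesD[OF *(8)] by blast
qed

lemma ET4_opD:
  assumes "realizes \<B> D f' B f A \<delta>" "realizes \<B> F g' C g B \<delta>'"
  obtains E d e h' \<delta>'' where "arr \<B> E D d" "arr \<B> F E e" "arr \<B> E C h'"
    "realizes \<B> E h' C (f \<cdot> g) A \<delta>''" "g \<cdot> h' = f' \<cdot> d" "h' \<cdot> e = g'"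
    "realizes \<B> F e E d D (pull \<B> F f' \<delta>')" "push \<B> A d \<delta>'' = \<delta>" "pull \<B> E f \<delta>'' = push \<B> B e \<delta>'"
proof -
  obtain E d e h' \<delta>'' where *: "E \<in> Obj \<B>" "d \<in> hom_set \<B> E D" "e \<in> hom_set \<B> F E" "h' \<in> hom_set \<B> E C"
    "realizes \<B> E h' C (f \<cdot> g) A \<delta>''" "g \<cdot> h' = f' \<cdot> d" "h' \<cdot> e = g'"
    "realizes \<B> F e E d D (pull \<B> F f' \<delta>')" "push \<B> A d \<delta>'' = \<delta>" "pull \<B> E f \<delta>'' = push \<B> B e \<delta>'"
    using et4_op[unfolded ET4_op_def, rule_format, OF conjI[OF assms]] by blast
  show ?thesis using that[OF _ _ _ *(5-10)] realizesD[OF *(5)] realizesD[OF *(8)] by blast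
qed

text \<open>
  Exactness of \<open>\<E>(C, Z) \<rightarrow> \<E>(B, Z) \<rightarrow> \<E>(A, Z)\<close>. If \<open>Z \<rightarrow> Q \<rightarrow> B\<close> realizes \<open>\<theta>\<close>, the dual of (ET4) applied
  to \<open>Q \<rightarrow> B \<rightarrow> C\<close> gives a class \<open>\<eta>\<close> over \<open>C\<close> with coefficients in an extension of \<open>A\<close> by \<open>Z\<close> of class
  \<open>x\<^sup>* \<theta>\<close>. That extension splits, and a retraction onto \<open>Z\<close> carries \<open>\<eta>\<close> to a preimage of \<open>\<theta>\<close>.
\<close>

lemma ext_exact_middle:
  assumes r: "realizes \<B> A x B y C \<delta>" and Z: "Z \<in> Obj \<B>"
    and \<theta>: "\<theta> \<in> carrier (Ext \<B> B Z)" and 0: "pull \<B> Z x \<theta> = \<one>\<^bsub>Ext \<B> A Z\<^esub>"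
  shows "\<exists>\<eta> \<in> carrier (Ext \<B> C Z). pull \<B> Z y \<eta> = \<theta>"
proof -
  note d = realizesD[OF r]
  obtain z Q q where t: "realizes \<B> Z z Q q B \<theta>" using realz_exists[OF Z d(5) \<theta>] by blast
  obtain E p e h' \<eta> where E: "arr \<B> E A p" "arr \<B> Z E e" "realizes \<B> E h' Q (y \<cdot> q) C \<eta>"
      "realizes \<B> Z e E p A (pull \<B> Z x \<theta>)" "pull \<B> E y \<eta> = push \<B> B e \<theta>"
    using ET4_opD[OF r t] by metis
  \<comment> \<open>The fibre of \<open>Q \<rightarrow> B \<rightarrow> C\<close> is a split extension of \<open>A\<close> by \<open>Z\<close>.\<close>
  obtain s where s: "arr \<B> E Z s" "s \<cdot> e = Ident \<B> Z"
    using extends_iff_push[OF E(4) arr_ident[OF Z]] 0 push_one[OF arr_ident[OF Z] d(4)] by auto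
  have "\<theta> = push \<B> B s (push \<B> B e \<theta>)"
    using push_cmp[OF E(2) s(1) d(5) \<theta>] s(2) push_ident[OF Z d(5) \<theta>] by simp
  also have "\<dots> = pull \<B> Z y (push \<B> C s \<eta>)"
    using push_pull[OF s(1) d(2) realizesD(3)[OF E(3)]] E(5) by simp
  finally show ?thesis using push_closed[OF s(1) d(6)] realizesD[OF E(3)] by metis
qed

lemma ext_exact_middle_push:
  assumes "realizes \<B> A x B y C \<delta>" "Z \<in> Obj \<B>"
    "\<theta> \<in> carrier (Ext \<B> Z B)" "push \<B> Z y \<theta> = \<one>\<^bsub>Ext \<B> Z C\<^esub>"
  shows "\<exists>\<eta> \<in> carrier (Ext \<B> Z A). push \<B> Z x \<eta> = \<theta>"
  using extriangulated_category.ext_exact_middle[OF opp_extriangulated, of C y B x A \<delta> Z \<theta>] assms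
  by (simp add: realizes_opp)

end

section \<open>Ideal quotients of additive categories\<close>

text \<open>
  The part of being abelian that the argument needs, for the full subcategory \<open>D\<close> of \<open>C/W\<close>, in terms
  of morphisms of \<open>C\<close> alone. Phrased without cosets, it is stated for the opposite category by
  reversing arrows.
\<close>

definition epis_are_cokernels :: "('o, 'm, 'z) cat_scheme \<Rightarrow> 'o set \<Rightarrow> 'o set \<Rightarrow> bool" where
  "epis_are_cokernels C W D \<longleftrightarrow> (\<forall>X Y \<alpha>. X \<in> D \<and> Y \<in> D \<and> arr C Y X \<alpha> \<and>
     (\<forall>Z \<in> D. \<forall>h. arr C X Z h \<and> h \<cdot>\<^bsub>C\<^esub> \<alpha> \<in> factoring C W Y Z \<longrightarrow> h \<in> factoring C W X Z) \<longrightarrow>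
     (\<exists>A \<in> D. \<exists>g. arr C A Y g \<and> \<alpha> \<cdot>\<^bsub>C\<^esub> g \<in> factoring C W A X \<and>
       (\<forall>Z \<in> D. \<forall>h. arr C Y Z h \<and> h \<cdot>\<^bsub>C\<^esub> g \<in> factoring C W A Z \<longrightarrow>
         (\<exists>k. arr C X Z k \<and> diff C Y Z (k \<cdot>\<^bsub>C\<^esub> \<alpha>) h \<in> factoring C W Y Z))))"

locale additive_ideal = additive_category +
  fixes W
  assumes W_zero: "is_zero_object C Z \<Longrightarrow> Z \<in> W"
    and W_sum: "is_biproduct C A B P i j p q \<Longrightarrow> A \<in> W \<Longrightarrow> B \<in> W \<Longrightarrow> P \<in> W"
begin

abbreviation I where "I \<equiv> factoring C W"
abbreviation Q where "Q \<equiv> ideal_quotient C W"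
abbreviation cls where "cls A B f \<equiv> I A B #>\<^bsub>Hom C A B\<^esub> f"

lemma idealE:
  assumes "f \<in> I A B" "A \<in> Obj C" "B \<in> Obj C"
  obtains Z u v where "Z \<in> W" "arr C A Z u" "arr C Z B v" "f = v \<cdot> u"
  using assms unfolding factoring_def arr_def by blast

lemma idealI: "Z \<in> W \<Longrightarrow> arr C A Z u \<Longrightarrow> arr C Z B v \<Longrightarrow> v \<cdot> u \<in> I A B"
  using arr_cmp[of A Z u B v] unfolding factoring_def arr_def by blast

lemma ideal_arr: "f \<in> I A B \<Longrightarrow> A \<in> Obj C \<Longrightarrow> B \<in> Obj C \<Longrightarrow> arr C A B f"
  by (auto simp: factoring_def arr_def)

lemma ideal_cmp_left:
  assumes "f \<in> I A B" "A \<in> Obj C" "arr C B D g"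
  shows "g \<cdot> f \<in> I A D"
proof -
  obtain Z u v where z: "Z \<in> W" "arr C A Z u" "arr C Z B v" "f = v \<cdot> u"
    using assms idealE arrD by metis
  then show ?thesis using idealI[OF z(1,2) arr_cmp[OF z(3) assms(3)]] assoc[OF z(2,3) assms(3)] by simp
qed

lemma ideal_cmp_right:
  assumes "f \<in> I A B" "B \<in> Obj C" "arr C D A g"
  shows "f \<cdot> g \<in> I D B"
proof -
  obtain Z u v where z: "Z \<in> W" "arr C A Z u" "arr C Z B v" "f = v \<cdot> u"
    using assms idealE arrD by metis
  then show ?thesis using idealI[OF z(1) arr_cmp[OF assms(3) z(2)] z(3)] assoc[OF assms(3) z(2,3)] by simp
qed

text \<open>
  The sum of \<open>v u\<close> and \<open>v' u'\<close> factors through the biproduct of the two objects of \<open>W\<close>.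
\<close>

lemma ideal_add:
  assumes f: "f \<in> I A B" and g: "g \<in> I A B" and o: "A \<in> Obj C" "B \<in> Obj C"
  shows "f \<otimes>\<^bsub>Hom C A B\<^esub> g \<in> I A B"
proof -
  obtain Z u v where z: "Z \<in> W" "arr C A Z u" "arr C Z B v" "f = v \<cdot> u" using f o idealE by metis
  obtain Z' u' v' where z': "Z' \<in> W" "arr C A Z' u'" "arr C Z' B v'" "g = v' \<cdot> u'" using g o idealE by metis
  obtain P i j p q where b: "is_biproduct C Z Z' P i j p q"
    using biproducts arrD(2)[OF z(2)] arrD(2)[OF z'(2)] by blast
  have a: "arr C Z P i" "arr C Z' P j" "arr C P Z p" "arr C P Z' q"
    using b by (auto simp: is_biproduct_def arr_def)
  have e: "p \<cdot> i = Ident C Z" "q \<cdot> j = Ident C Z'" "q \<cdot> i = zero_mor C Z Z'" "p \<cdot> j = zero_mor C Z' Z"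
    using b by (auto simp: is_biproduct_def)
  define s where "s = (i \<cdot> u) \<otimes>\<^bsub>Hom C A P\<^esub> (j \<cdot> u')"
  note iu = arr_cmp[OF z(2) a(1)] and ju = arr_cmp[OF z'(2) a(2)]
  have s: "arr C A P s" unfolding s_def by (rule arr_add[OF iu ju])
  have ps: "p \<cdot> s = u"
    unfolding s_def cmp_add[OF iu ju a(3)] assoc[OF z(2) a(1,3), symmetric]
      assoc[OF z'(2) a(2,3), symmetric] e
    by (simp add: ident_cmp[OF z(2)] zero_cmp[OF z'(2)] add_zero[OF z(2)] arrD[OF z(2)])
  have qs: "q \<cdot> s = u'"
    unfolding s_def cmp_add[OF iu ju a(4)] assoc[OF z(2) a(1,4), symmetric]
      assoc[OF z'(2) a(2,4), symmetric] e
    by (simp add: ident_cmp[OF z'(2)] zero_cmp[OF z(2)] add_zero[OF z'(2)] arrD[OF z'(2)])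
  note vp = arr_cmp[OF a(3) z(3)] and vq = arr_cmp[OF a(4) z'(3)]
  have "((v \<cdot> p) \<otimes>\<^bsub>Hom C P B\<^esub> (v' \<cdot> q)) \<cdot> s = f \<otimes>\<^bsub>Hom C A B\<^esub> g"
    unfolding add_cmp[OF s vp vq] assoc[OF s a(3) z(3)] assoc[OF s a(4) z'(3)] ps qs z(4) z'(4) ..
  then show ?thesis using idealI[OF W_sum[OF b z(1) z'(1)] s arr_add[OF vp vq]] by simp
qed

lemma ideal_subgroup:
  assumes "A \<in> Obj C" "B \<in> Obj C"
  shows "subgroup (I A B) (Hom C A B)"
proof (rule group.subgroupI[OF hom_group[OF assms]])
  show "I A B \<subseteq> hom_set C A B" by (auto simp: factoring_def)
  obtain Z where Z: "is_zero_object C Z" using zero_object by blast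
  then have "Z \<in> Obj C" by (simp add: is_zero_object_def)
  then show "I A B \<noteq> {}" using idealI[OF W_zero[OF Z] arr_zero arr_zero] assms by blast
  fix f assume f: "f \<in> I A B"
  then obtain Z u v where z: "Z \<in> W" "arr C A Z u" "arr C Z B v" "f = v \<cdot> u" using assms idealE by metis
  then show "inv\<^bsub>Hom C A B\<^esub> f \<in> I A B" using neg_cmp[OF z(2,3)] idealI[OF z(1,2) arr_neg[OF z(3)]] by simp
  fix g assume "g \<in> I A B"
  then show "f \<otimes>\<^bsub>Hom C A B\<^esub> g \<in> I A B" using f assms ideal_add by blast
qed

lemma zero_in_ideal: "A \<in> Obj C \<Longrightarrow> B \<in> Obj C \<Longrightarrow> zero_mor C A B \<in> I A B"
  using ideal_subgroup subgroup.one_closed by blast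

lemma ideal_diff_sym:
  assumes "diff C A B f g \<in> I A B" "arr C A B f" "arr C A B g"
  shows "diff C A B g f \<in> I A B"
proof -
  interpret comm_group "Hom C A B" using assms hom_comm_group by (simp add: arr_def)
  have "inv\<^bsub>Hom C A B\<^esub> (diff C A B f g) = diff C A B g f"
    using assms by (simp add: arr_def inv_mult m_comm)
  then show ?thesis using subgroup.m_inv_closed[OF ideal_subgroup assms(1)] assms by (simp add: arr_def)
qed

lemma ideal_diff_trans:
  assumes "diff C A B f g \<in> I A B" "diff C A B g h \<in> I A B" "arr C A B f" "arr C A B g" "arr C A B h"
  shows "diff C A B f h \<in> I A B"
proof -
  interpret comm_group "Hom C A B" using assms hom_comm_group by (simp add: arr_def)
  have m: "f \<in> hom_set C A B" "g \<in> hom_set C A B" "h \<in> hom_set C A B" using assms by (auto simp: arr_def)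
  have "inv\<^bsub>Hom C A B\<^esub> g \<otimes>\<^bsub>Hom C A B\<^esub> diff C A B g h = inv\<^bsub>Hom C A B\<^esub> h"
    using m m_assoc[of "inv\<^bsub>Hom C A B\<^esub> g" g "inv\<^bsub>Hom C A B\<^esub> h"] by simp
  then have "diff C A B f g \<otimes>\<^bsub>Hom C A B\<^esub> diff C A B g h = diff C A B f h"
    using m m_assoc[of f "inv\<^bsub>Hom C A B\<^esub> g" "diff C A B g h"] by simp
  then show ?thesis using ideal_add[OF assms(1,2)] assms by (simp add: arr_def)
qed

lemma diff_ideal_iff:
  assumes "g \<in> I A B" "arr C A B f"
  shows "diff C A B f g \<in> I A B \<longleftrightarrow> f \<in> I A B"
proof -
  note o = arrD(1,2)[OF assms(2)]
  interpret subgroup "I A B" "Hom C A B" using ideal_subgroup[OF o] .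
  note g = ideal_arr[OF assms(1) o]
  show ?thesis using ideal_add[OF _ assms(1) o] diff_add(1)[OF assms(2) g] ideal_add[OF _ m_inv_closed[OF assms(1)] o]
    by metis
qed

lemma cls_eq_iff:
  assumes "arr C A B f" "arr C A B g"
  shows "cls A B f = cls A B g \<longleftrightarrow> diff C A B f g \<in> I A B"
proof -
  note o = arrD(1,2)[OF assms(1)]
  interpret group "Hom C A B" using hom_group[OF o] .
  note sg = ideal_subgroup[OF o]
  have "cls A B f = cls A B g \<longleftrightarrow> f \<in> cls A B g"
    using rcos_self[OF arrD(3)[OF assms(1)] sg] repr_independence[OF _ arrD(3)[OF assms(2)] sg] by blast
  then show ?thesis
    using subgroup.rcos_module[OF sg is_group arrD(3)[OF assms(2)] arrD(3)[OF assms(1)]] by simp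
qed

lemma cls_eq_ideal_iff:
  assumes "arr C A B f"
  shows "cls A B f = I A B \<longleftrightarrow> f \<in> I A B"
proof -
  note o = arrD(1,2)[OF assms]
  interpret group "Hom C A B" using hom_group[OF o] .
  have "I A B = cls A B (zero_mor C A B)"
    using coset_mult_one[of "I A B"] subgroup.subset[OF ideal_subgroup[OF o]] by simp
  moreover have "diff C A B f (zero_mor C A B) = f" using arrD[OF assms] by simp
  ultimately show ?thesis using cls_eq_iff[OF assms arr_zero[OF o]] by simp
qed

lemma quotient_simps [simp]:
  "Obj Q = Obj C"
  "zero_mor Q A B = I A B"
  "Ident Q A = cls A A (Ident C A)"
  by (simp_all add: ideal_quotient_def FactGroup_def)

lemma quotient_hom:
  "F \<in> hom_set Q A B \<longleftrightarrow> (\<exists>f \<in> hom_set C A B. F = cls A B f)"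
  by (auto simp: ideal_quotient_def FactGroup_def RCOSETS_def)

lemma cls_arr:
  assumes "arr C A B f" "f' \<in> cls A B f"
  shows "arr C A B f'" "diff C A B f' f \<in> I A B"
proof -
  note o = arrD(1,2)[OF assms(1)]
  interpret group "Hom C A B" using hom_group[OF o] .
  note sg = ideal_subgroup[OF o]
  show "arr C A B f'"
    using r_coset_subset_G[OF subgroup.subset[OF sg] arrD(3)[OF assms(1)]] assms o by (auto simp: arr_def)
  then show "diff C A B f' f \<in> I A B"
    using subgroup.rcos_module[OF sg is_group arrD(3)[OF assms(1)]] assms by (simp add: arr_def)
qed

lemma cls_self: "arr C A B f \<Longrightarrow> f \<in> cls A B f"
  using group.rcos_self[OF hom_group] ideal_subgroup by (simp add: arr_def)

lemma cmp_congruent: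
  assumes f: "arr C A B f" "arr C A B f'" "diff C A B f' f \<in> I A B"
    and g: "arr C B D g" "arr C B D g'" "diff C B D g' g \<in> I B D"
  shows "diff C A D (g' \<cdot> f') (g \<cdot> f) \<in> I A D"
proof -
  have "diff C A D (g' \<cdot> f') (g' \<cdot> f) \<in> I A D"
    using ideal_cmp_left[OF f(3) arrD(1)[OF f(1)] g(2)] cmp_diff[OF f(2,1) g(2)] by simp
  moreover have "diff C A D (g' \<cdot> f) (g \<cdot> f) \<in> I A D"
    using ideal_cmp_right[OF g(3) arrD(2)[OF g(1)] f(1)] diff_cmp[OF f(1) g(2,1)] by simp
  ultimately show ?thesis
    using ideal_diff_trans[OF _ _ arr_cmp[OF f(2) g(2)] arr_cmp[OF f(1) g(2)] arr_cmp[OF f(1) g(1)]] by simp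
qed

text \<open>
  The composite of cosets is given by a definite description: it is the one coset, in whichever hom
  group, that contains the composites of all representatives. Disjointness of the hom-sets pins down
  the hom group, and the ideal property shows that all these composites are congruent.
\<close>

lemma quotient_cmp:
  assumes f: "arr C A B f" and g: "arr C B D g"
  shows "cls B D g \<cdot>\<^bsub>Q\<^esub> cls A B f = cls A D (g \<cdot> f)"
proof -
  let ?P = "\<lambda>K. (\<exists>A \<in> Obj C. \<exists>B \<in> Obj C. K \<in> carrier (Hom C A B Mod I A B)) \<and>
    (\<forall>g \<in> cls B D g. \<forall>f \<in> cls A B f. g \<cdot> f \<in> K)"
  have K: "K \<in> carrier (Hom C A B Mod I A B) \<longleftrightarrow> (\<exists>f \<in> hom_set C A B. K = cls A B f)" for K A B
    by (auto simp: FactGroup_def RCOSETS_def)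
  note gf = arr_cmp[OF f g]
  have "(THE K. ?P K) = cls A D (g \<cdot> f)"
  proof (rule the_equality)
    have "g' \<cdot> f' \<in> cls A D (g \<cdot> f)" if h: "g' \<in> cls B D g" "f' \<in> cls A B f" for g' f'
    proof -
      note f' = cls_arr[OF f h(2)] and g' = cls_arr[OF g h(1)]
      have "cls A D (g' \<cdot> f') = cls A D (g \<cdot> f)"
        using cls_eq_iff[OF arr_cmp[OF f'(1) g'(1)] gf] cmp_congruent[OF f f' g g'] by simp
      then show ?thesis using cls_self[OF arr_cmp[OF f'(1) g'(1)]] by simp
    qed
    then show "?P (cls A D (g \<cdot> f))" using gf K unfolding arr_def by blast
  next
    fix K assume h: "?P K"
    then obtain A' D' k where k: "arr C A' D' k" "K = cls A' D' k" unfolding K arr_def by blast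
    have gfK: "g \<cdot> f \<in> K" using h cls_self[OF f] cls_self[OF g] by blast
    then have m: "arr C A' D' (g \<cdot> f)" "diff C A' D' (g \<cdot> f) k \<in> I A' D'" using cls_arr k by blast+
    then have "A' = A" "D' = D" using hom_disjoint gf unfolding arr_def by blast+
    then show "K = cls A D (g \<cdot> f)" using cls_eq_iff[OF m(1) k(1)] m k by simp
  qed
  then show ?thesis by (simp add: ideal_quotient_def)
qed

lemma quotient_cmp_ident_iff:
  assumes "arr C X Y f" "arr C Y X g"
  shows "cls Y X g \<cdot>\<^bsub>Q\<^esub> cls X Y f = Ident Q X \<longleftrightarrow> diff C X X (g \<cdot> f) (Ident C X) \<in> I X X"
  using cls_eq_iff[OF arr_cmp[OF assms] arr_ident] quotient_cmp[OF assms] arrD[OF assms(1)] by simp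

lemma quotient_isomorphic_iff:
  "isomorphic Q X Y \<longleftrightarrow> (\<exists>f g. arr C X Y f \<and> arr C Y X g \<and>
     diff C X X (g \<cdot> f) (Ident C X) \<in> I X X \<and> diff C Y Y (f \<cdot> g) (Ident C Y) \<in> I Y Y)"
proof
  assume "isomorphic Q X Y"
  then obtain F G where o: "X \<in> Obj C" "Y \<in> Obj C" and FG: "F \<in> hom_set Q X Y" "G \<in> hom_set Q Y X"
    "G \<cdot>\<^bsub>Q\<^esub> F = Ident Q X" "F \<cdot>\<^bsub>Q\<^esub> G = Ident Q Y"
    unfolding isomorphic_def is_iso_def quotient_simps(1) by blast
  then obtain f g where "arr C X Y f" "F = cls X Y f" "arr C Y X g" "G = cls Y X g"
    unfolding quotient_hom arr_def by blast
  then show "\<exists>f g. arr C X Y f \<and> arr C Y X g \<and>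
     diff C X X (g \<cdot> f) (Ident C X) \<in> I X X \<and> diff C Y Y (f \<cdot> g) (Ident C Y) \<in> I Y Y"
    using FG(3,4) quotient_cmp_ident_iff by blast
next
  assume "\<exists>f g. arr C X Y f \<and> arr C Y X g \<and>
     diff C X X (g \<cdot> f) (Ident C X) \<in> I X X \<and> diff C Y Y (f \<cdot> g) (Ident C Y) \<in> I Y Y"
  then obtain f g where fg: "arr C X Y f" "arr C Y X g" "cls Y X g \<cdot>\<^bsub>Q\<^esub> cls X Y f = Ident Q X"
    "cls X Y f \<cdot>\<^bsub>Q\<^esub> cls Y X g = Ident Q Y"
    using quotient_cmp_ident_iff by blast
  then have "cls X Y f \<in> hom_set Q X Y" "cls Y X g \<in> hom_set Q Y X"
    using quotient_hom unfolding arr_def by blast+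
  then show "isomorphic Q X Y"
    unfolding isomorphic_def is_iso_def quotient_simps(1) using fg(3,4) arrD(1,2)[OF fg(1)] by blast
qed

lemma quotient_eq_cmp_iff:
  assumes f: "arr C A B f" and gh: "arr C B D g" "arr C B D h"
  shows "cls B D g \<cdot>\<^bsub>Q\<^esub> cls A B f = cls B D h \<cdot>\<^bsub>Q\<^esub> cls A B f \<longleftrightarrow> diff C B D g h \<cdot> f \<in> I A D"
  unfolding quotient_cmp[OF f gh(1)] quotient_cmp[OF f gh(2)]
    cls_eq_iff[OF arr_cmp[OF f gh(1)] arr_cmp[OF f gh(2)]] diff_cmp[OF f gh] ..

lemma quotient_cmp_eq_iff:
  assumes g: "arr C B D g" and fh: "arr C A B f" "arr C A B h"
  shows "cls B D g \<cdot>\<^bsub>Q\<^esub> cls A B f = cls B D g \<cdot>\<^bsub>Q\<^esub> cls A B h \<longleftrightarrow> g \<cdot> diff C A B f h \<in> I A D"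
  unfolding quotient_cmp[OF fh(1) g] quotient_cmp[OF fh(2) g]
    cls_eq_iff[OF arr_cmp[OF fh(1) g] arr_cmp[OF fh(2) g]] cmp_diff[OF fh g] ..

lemma quotient_cmp_zero_iff:
  assumes "arr C A B f" "arr C B D g"
  shows "cls B D g \<cdot>\<^bsub>Q\<^esub> cls A B f = I A D \<longleftrightarrow> g \<cdot> f \<in> I A D"
  unfolding quotient_cmp[OF assms] using cls_eq_ideal_iff[OF arr_cmp[OF assms]] .

lemma full_subcat_simps:
  "Obj (full_subcat Q D) = D \<inter> Obj C" "Hom (full_subcat Q D) = Hom Q" "Cmp (full_subcat Q D) = Cmp Q"
  "Ident (full_subcat Q D) = Ident Q"
  by (simp_all add: full_subcat_def)

text \<open>
  By additivity a morphism can be tested for being epi against single morphisms instead of pairs,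
  so the hypothesis of \<open>epis_are_cokernels\<close> says that the coset of \<open>\<alpha>\<close> is epi in \<open>D\<close>.
\<close>

lemma abelian_epis_are_cokernels:
  assumes ab: "abelian_category (full_subcat Q D)" and D: "D \<subseteq> Obj C"
  shows "epis_are_cokernels C W D"
  unfolding epis_are_cokernels_def
proof (intro allI impI, elim conjE)
  fix X Y \<alpha> assume X: "X \<in> D" and Y: "Y \<in> D" and \<alpha>: "arr C Y X \<alpha>"
    and epi: "\<forall>Z \<in> D. \<forall>h. arr C X Z h \<and> h \<cdot> \<alpha> \<in> I Y Z \<longrightarrow> h \<in> I X Z"
  have "is_epi (full_subcat Q D) Y X (cls Y X \<alpha>)"
    unfolding is_epi_def full_subcat_simps
  proof (intro conjI ballI impI)
    show "cls Y X \<alpha> \<in> hom_set Q Y X" using \<alpha> quotient_hom by (auto simp: arr_def)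
    fix Z G H assume Z: "Z \<in> D \<inter> Obj C" and GH: "G \<in> hom_set Q X Z" "H \<in> hom_set Q X Z"
      and eq: "G \<cdot>\<^bsub>Q\<^esub> cls Y X \<alpha> = H \<cdot>\<^bsub>Q\<^esub> cls Y X \<alpha>"
    obtain g h where gh: "arr C X Z g" "G = cls X Z g" "arr C X Z h" "H = cls X Z h"
      using GH Z X D unfolding quotient_hom arr_def by blast
    have "diff C X Z g h \<cdot> \<alpha> \<in> I Y Z" using eq quotient_eq_cmp_iff[OF \<alpha> gh(1,3)] gh by simp
    then have "diff C X Z g h \<in> I X Z" using epi Z arr_diff[OF gh(1,3)] by blast
    then show "G = H" using cls_eq_iff[OF gh(1,3)] gh by simp
  qed
  then obtain A G where A: "A \<in> D" "A \<in> Obj C" and G: "G \<in> hom_set Q A Y"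
    and ck: "is_cokernel (full_subcat Q D) A Y G X (cls Y X \<alpha>)"
    using abelian_category.epi_is_cokernel[OF ab, of Y X] X Y D unfolding full_subcat_simps by blast
  obtain g where g: "arr C A Y g" "G = cls A Y g" using G A Y D unfolding quotient_hom arr_def by blast
  have 1: "\<alpha> \<cdot> g \<in> I A X"
    using ck quotient_cmp_zero_iff[OF g(1) \<alpha>] g(2)
    unfolding is_cokernel_def full_subcat_simps quotient_simps by simp
  have 2: "\<exists>k. arr C X Z k \<and> diff C Y Z (k \<cdot> \<alpha>) h \<in> I Y Z"
    if Z: "Z \<in> D" and h: "arr C Y Z h" "h \<cdot> g \<in> I A Z" for Z h
  proof -
    have "cls Y Z h \<cdot>\<^bsub>Q\<^esub> G = I A Z" using quotient_cmp_zero_iff[OF g(1) h(1)] h(2) g(2) by simp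
    moreover have "cls Y Z h \<in> hom_set Q Y Z" using h(1) quotient_hom by (auto simp: arr_def)
    ultimately obtain K where K: "K \<in> hom_set Q X Z" "K \<cdot>\<^bsub>Q\<^esub> cls Y X \<alpha> = cls Y Z h"
      using ck Z D unfolding is_cokernel_def full_subcat_simps quotient_simps by blast
    obtain k where k: "arr C X Z k" "K = cls X Z k" using K(1) X Z D unfolding quotient_hom arr_def by blast
    then show ?thesis
      using K(2) quotient_cmp[OF \<alpha> k(1)] cls_eq_iff[OF arr_cmp[OF \<alpha> k(1)] h(1)] by auto
  qed
  show "\<exists>A \<in> D. \<exists>g. arr C A Y g \<and> \<alpha> \<cdot> g \<in> I A X \<and>
      (\<forall>Z \<in> D. \<forall>h. arr C Y Z h \<and> h \<cdot> g \<in> I A Z \<longrightarrow>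
        (\<exists>k. arr C X Z k \<and> diff C Y Z (k \<cdot> \<alpha>) h \<in> I Y Z))"
    using A g 1 2 by blast
qed

lemma abelian_monos_are_kernels:
  assumes ab: "abelian_category (full_subcat Q D)" and D: "D \<subseteq> Obj C"
    and X: "X \<in> D" and Y: "Y \<in> D" and \<alpha>: "arr C X Y \<alpha>"
    and mono: "\<And>Z h. Z \<in> D \<Longrightarrow> arr C Z X h \<Longrightarrow> \<alpha> \<cdot> h \<in> I Z Y \<Longrightarrow> h \<in> I Z X"
  shows "\<exists>A \<in> D. \<exists>g. arr C Y A g \<and> g \<cdot> \<alpha> \<in> I X A \<and>
      (\<forall>Z \<in> D. \<forall>h. arr C Z Y h \<and> g \<cdot> h \<in> I Z A \<longrightarrow>
        (\<exists>k. arr C Z X k \<and> diff C Z Y (\<alpha> \<cdot> k) h \<in> I Z Y))"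
proof -
  have "is_mono (full_subcat Q D) X Y (cls X Y \<alpha>)"
    unfolding is_mono_def full_subcat_simps
  proof (intro conjI ballI impI)
    show "cls X Y \<alpha> \<in> hom_set Q X Y" using \<alpha> quotient_hom by (auto simp: arr_def)
    fix Z G H assume Z: "Z \<in> D \<inter> Obj C" and GH: "G \<in> hom_set Q Z X" "H \<in> hom_set Q Z X"
      and eq: "cls X Y \<alpha> \<cdot>\<^bsub>Q\<^esub> G = cls X Y \<alpha> \<cdot>\<^bsub>Q\<^esub> H"
    obtain g h where gh: "arr C Z X g" "G = cls Z X g" "arr C Z X h" "H = cls Z X h"
      using GH Z X D unfolding quotient_hom arr_def by blast
    have "\<alpha> \<cdot> diff C Z X g h \<in> I Z Y" using eq quotient_cmp_eq_iff[OF \<alpha> gh(1,3)] gh by simp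
    then have "diff C Z X g h \<in> I Z X" using mono Z arr_diff[OF gh(1,3)] by blast
    then show "G = H" using cls_eq_iff[OF gh(1,3)] gh by simp
  qed
  then obtain A G where A: "A \<in> D" "A \<in> Obj C" and G: "G \<in> hom_set Q Y A"
    and ck: "is_kernel (full_subcat Q D) Y A G X (cls X Y \<alpha>)"
    using abelian_category.mono_is_kernel[OF ab, of X Y] X Y D unfolding full_subcat_simps by blast
  obtain g where g: "arr C Y A g" "G = cls Y A g" using G A Y D unfolding quotient_hom arr_def by blast
  have 1: "g \<cdot> \<alpha> \<in> I X A"
    using ck quotient_cmp_zero_iff[OF \<alpha> g(1)] g(2)
    unfolding is_kernel_def full_subcat_simps quotient_simps by simp
  have 2: "\<exists>k. arr C Z X k \<and> diff C Z Y (\<alpha> \<cdot> k) h \<in> I Z Y"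
    if Z: "Z \<in> D" and h: "arr C Z Y h" "g \<cdot> h \<in> I Z A" for Z h
  proof -
    have "G \<cdot>\<^bsub>Q\<^esub> cls Z Y h = I Z A" using quotient_cmp_zero_iff[OF h(1) g(1)] h(2) g(2) by simp
    moreover have "cls Z Y h \<in> hom_set Q Z Y" using h(1) quotient_hom by (auto simp: arr_def)
    ultimately obtain K where K: "K \<in> hom_set Q Z X" "cls X Y \<alpha> \<cdot>\<^bsub>Q\<^esub> K = cls Z Y h"
      using ck Z D unfolding is_kernel_def full_subcat_simps quotient_simps by blast
    obtain k where k: "arr C Z X k" "K = cls Z X k" using K(1) X Z D unfolding quotient_hom arr_def by blast
    then show ?thesis
      using K(2) quotient_cmp[OF k(1) \<alpha>] cls_eq_iff[OF arr_cmp[OF k(1) \<alpha>] h(1)] by auto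
  qed
  show ?thesis using A g 1 2 by blast
qed

end

section \<open>Cotorsion pairs\<close>

abbreviation ext_vanishes :: "('o, 'm, 'e, 'z) extri_scheme \<Rightarrow> 'o \<Rightarrow> 'o \<Rightarrow> bool" where
  "ext_vanishes \<B> X Y \<equiv> carrier (Ext \<B> X Y) = {\<one>\<^bsub>Ext \<B> X Y\<^esub>}"

context extriangulated_category
begin

lemma E_triangle_opp [simp]: "E_triangle (opp \<B>) A M C \<longleftrightarrow> E_triangle \<B> C M A"
  unfolding E_triangle_def realizes_opp by blast

lemma cone_classE:
  assumes "X \<in> cone_class \<B> V' W'"
  obtains v w x y \<delta> where "v \<in> V'" "w \<in> W'" "realizes \<B> v x w y X \<delta>"
  using assms by (auto simp: cone_class_def E_triangle_def)

lemma cocone_classE: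
  assumes "X \<in> cocone_class \<B> W' S'"
  obtains s w x y \<delta> where "s \<in> S'" "w \<in> W'" "realizes \<B> X x w y s \<delta>"
  using assms by (auto simp: cocone_class_def E_triangle_def)

lemma cone_classI: "v \<in> V' \<Longrightarrow> w \<in> W' \<Longrightarrow> realizes \<B> v x w y X \<delta> \<Longrightarrow> X \<in> cone_class \<B> V' W'"
  using realizesD(6)[of v x w y X \<delta>] unfolding cone_class_def E_triangle_def by blast

lemma cocone_classI: "s \<in> S' \<Longrightarrow> w \<in> W' \<Longrightarrow> realizes \<B> X x w y s \<delta> \<Longrightarrow> X \<in> cocone_class \<B> W' S'"
  using realizesD(4)[of X x w y s \<delta>] unfolding cocone_class_def E_triangle_def by blast

lemma cone_class_opp: "cone_class (opp \<B>) V W = cocone_class \<B> W V"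
  and cocone_class_opp: "cocone_class (opp \<B>) W V = cone_class \<B> V W"
  by (auto simp: cone_class_def cocone_class_def)

lemma cotorsion_pair_opp: "cotorsion_pair (opp \<B>) V U \<longleftrightarrow> cotorsion_pair \<B> U V"
  by (auto simp: cotorsion_pair_def; blast)

lemma realizes_unique:
  assumes "realizes \<B> A x B y C \<delta>" "realizes \<B> A x' B' y' C \<delta>"
  shows "isomorphic \<B> B B'"
proof -
  note d = realizesD[OF assms(2)]
  have "is_iso \<B> B' B' (Ident \<B> B')"
    unfolding is_iso_def using arr_ident[OF d(5)] ident_cmp[OF arr_ident[OF d(5)]] by (auto simp: arr_def)
  then have "((B', x', y'), (B', x', y')) \<in> seq_equiv \<B> A C"
    using ident_cmp[OF d(1)] cmp_ident[OF d(2)] assms(2) unfolding seq_equiv_def realizes_def by blast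
  then have "((B, x, y), (B', x', y')) \<in> seq_equiv \<B> A C"
    using assms unfolding realizes_def by blast
  then show ?thesis using assms d realizesD[OF assms(1)] unfolding seq_equiv_def isomorphic_def by blast
qed

text \<open>
  A triangle with vanishing class is isomorphic to the direct sum one, so that its first term is a
  genuine summand, with a complement, of the middle term.
\<close>

lemma split_summand:
  assumes "realizes \<B> A x B y C \<one>\<^bsub>Ext \<B> C A\<^esub>" and B: "B \<in> D"
    and D: "subcategory \<B> D" "closed_under_summands \<B> D"
  shows "A \<in> D"
proof -
  note d = realizesD[OF assms(1)]
  obtain P i j p q where b: "is_biproduct \<B> A C P i j p q" using biproducts d by blast
  have "P \<in> D" using realizes_unique[OF assms(1) realz_zero[OF b]] D(1) B by (auto simp: subcategory_def)
  then show ?thesis using D(2) b unfolding closed_under_summands_def by blast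
qed

text \<open>
  \<open>V\<close> is the full right orthogonal of \<open>U\<close>: for \<open>Y\<close> in the orthogonal, the triangle \<open>Y \<rightarrow> M \<rightarrow> X\<close> with
  \<open>M \<in> V\<close> and \<open>X \<in> U\<close> has vanishing class, so that \<open>Y\<close> is a direct summand of \<open>M\<close>.
\<close>

lemma cotorsion_right_iff:
  assumes c: "cotorsion_pair \<B> U V"
  shows "Y \<in> V \<longleftrightarrow> Y \<in> Obj \<B> \<and> (\<forall>X \<in> U. ext_vanishes \<B> X Y)"
proof
  show "Y \<in> Obj \<B> \<and> (\<forall>X \<in> U. ext_vanishes \<B> X Y)" if "Y \<in> V"
    using that c unfolding cotorsion_pair_def subcategory_def by blast
  assume Y: "Y \<in> Obj \<B> \<and> (\<forall>X \<in> U. ext_vanishes \<B> X Y)"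
  then obtain M X x y \<delta> where r: "M \<in> V" "X \<in> U" "realizes \<B> Y x M y X \<delta>"
    using c unfolding cotorsion_pair_def E_triangle_def by metis
  have "\<delta> = \<one>\<^bsub>Ext \<B> X Y\<^esub>" using realizesD(3)[OF r(3)] Y r(2) by blast
  then show "Y \<in> V" using split_summand[of Y x M y X V] r c unfolding cotorsion_pair_def by simp
qed

lemma cotorsion_left_iff:
  assumes c: "cotorsion_pair \<B> U V"
  shows "X \<in> U \<longleftrightarrow> X \<in> Obj \<B> \<and> (\<forall>Y \<in> V. ext_vanishes \<B> X Y)"
  using extriangulated_category.cotorsion_right_iff[OF opp_extriangulated cotorsion_pair_opp[THEN iffD2, OF c]]
  by simp

lemma cotorsion_right_extension:
  assumes c: "cotorsion_pair \<B> U V" and r: "realizes \<B> A x B y C \<delta>" and AC: "A \<in> V" "C \<in> V"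
  shows "B \<in> V"
  unfolding cotorsion_right_iff[OF c]
proof (intro conjI ballI)
  note d = realizesD[OF r]
  show "B \<in> Obj \<B>" using d by simp
  fix X assume X: "X \<in> U"
  then have X': "X \<in> Obj \<B>" and v: "ext_vanishes \<B> X A" "ext_vanishes \<B> X C"
    using cotorsion_left_iff[OF c] AC by blast+
  have "\<theta> = \<one>\<^bsub>Ext \<B> X B\<^esub>" if \<theta>: "\<theta> \<in> carrier (Ext \<B> X B)" for \<theta>
  proof -
    have "push \<B> X y \<theta> = \<one>\<^bsub>Ext \<B> X C\<^esub>" using push_closed[OF d(2) X' \<theta>] v by simp
    then obtain \<eta> where "\<eta> \<in> carrier (Ext \<B> X A)" "push \<B> X x \<eta> = \<theta>"
      using ext_exact_middle_push[OF r X' \<theta>] by blast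
    then show ?thesis using v push_one[OF d(1) X'] by simp
  qed
  then show "ext_vanishes \<B> X B" using ext_one_closed[OF X' d(5)] by blast
qed

lemma cotorsion_left_extension:
  assumes "cotorsion_pair \<B> U V" "realizes \<B> A x B y C \<delta>" "A \<in> U" "C \<in> U"
  shows "B \<in> U"
  using extriangulated_category.cotorsion_right_extension[OF opp_extriangulated
      cotorsion_pair_opp[THEN iffD2, OF assms(1)], of C y B x A \<delta>] assms
  by (simp add: realizes_opp)

lemma cotorsion_right_zero:
  assumes c: "cotorsion_pair \<B> U V" and Z: "is_zero_object \<B> Z"
  shows "Z \<in> V"
  unfolding cotorsion_right_iff[OF c]
proof (intro conjI ballI)
  show o: "Z \<in> Obj \<B>" using Z by (simp add: is_zero_object_def)
  fix X assume "X \<in> U"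
  then have X: "X \<in> Obj \<B>" using cotorsion_left_iff[OF c] by blast
  have "Ident \<B> Z = zero_mor \<B> Z Z" using zero_object_arr_eq(1)[OF Z arr_ident[OF o] arr_zero[OF o o]] .
  then have "\<theta> = \<one>\<^bsub>Ext \<B> X Z\<^esub>" if "\<theta> \<in> carrier (Ext \<B> X Z)" for \<theta>
    using push_ident[OF o X that] push_zero[OF o o X that] by simp
  then show "ext_vanishes \<B> X Z" using ext_one_closed[OF X o] by blast
qed

lemma cotorsion_left_zero:
  assumes "cotorsion_pair \<B> U V" "is_zero_object \<B> Z"
  shows "Z \<in> U"
  using extriangulated_category.cotorsion_right_zero[OF opp_extriangulated
      cotorsion_pair_opp[THEN iffD2, OF assms(1)], of Z] assms by simp

lemma push_vanishing:
  "ext_vanishes \<B> X Y \<Longrightarrow> arr \<B> A Y a \<Longrightarrow> X \<in> Obj \<B> \<Longrightarrow> \<delta> \<in> carrier (Ext \<B> X A) \<Longrightarrow>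
    push \<B> X a \<delta> = \<one>\<^bsub>Ext \<B> X Y\<^esub>"
  using push_closed by blast

lemma push_through_vanishing:
  assumes "ext_vanishes \<B> X Z" "arr \<B> A Z a" "arr \<B> Z B b" "X \<in> Obj \<B>" "\<theta> \<in> carrier (Ext \<B> X A)"
  shows "push \<B> X (b \<cdot> a) \<theta> = \<one>\<^bsub>Ext \<B> X B\<^esub>"
  using push_cmp[OF assms(2,3,4,5)] push_vanishing[OF assms(1,2,4,5)] push_one[OF assms(3,4)] by simp

lemma extends_if_vanishes:
  assumes r: "realizes \<B> A x B y C \<delta>" and h: "arr \<B> A Z h" and v: "ext_vanishes \<B> C Z"
  shows "\<exists>k. arr \<B> B Z k \<and> k \<cdot> x = h"
  using extends_iff_push[OF r h] push_vanishing[OF v h] realizesD[OF r] by blast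

lemma lifts_if_vanishes:
  assumes "realizes \<B> A x B y C \<delta>" and "arr \<B> Z C h" and "ext_vanishes \<B> Z A"
  shows "\<exists>k. arr \<B> Z B k \<and> y \<cdot> k = h"
  using extriangulated_category.extends_if_vanishes[OF opp_extriangulated, of C y B x A \<delta> Z h] assms
  by (simp add: realizes_opp)

end

locale twin_cotorsion = extriangulated_category \<B>
  for \<B> :: "('o, 'm, 'e, 'z) extri_scheme" (structure) +
  fixes S T U V :: "'o set"
  assumes twin: "twin_cotorsion_pair \<B> S T U V"
begin

lemma ST: "cotorsion_pair \<B> S T" and UV: "cotorsion_pair \<B> U V" and SU: "S \<subseteq> U"
  using twin by (auto simp: twin_cotorsion_pair_def)

lemma VT: "V \<subseteq> T"
  using SU cotorsion_right_iff[OF ST] cotorsion_right_iff[OF UV] by blast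

lemma twin_cotorsion_opp: "twin_cotorsion (opp \<B>) V U T S"
  using ST UV VT opp_extriangulated
  by (simp add: twin_cotorsion_def twin_cotorsion_axioms_def twin_cotorsion_pair_def cotorsion_pair_opp)

lemma sets_obj: "X \<in> S \<Longrightarrow> X \<in> Obj \<B>" "X \<in> T \<Longrightarrow> X \<in> Obj \<B>" "X \<in> U \<Longrightarrow> X \<in> Obj \<B>" "X \<in> V \<Longrightarrow> X \<in> Obj \<B>"
  using ST UV by (auto simp: cotorsion_pair_def subcategory_def)

lemma ST_vanish: "X \<in> S \<Longrightarrow> Y \<in> T \<Longrightarrow> ext_vanishes \<B> X Y"
  and UV_vanish: "X \<in> U \<Longrightarrow> Y \<in> V \<Longrightarrow> ext_vanishes \<B> X Y"
  using ST UV by (auto simp: cotorsion_pair_def)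

text \<open>
  A biproduct is a middle term of a split triangle, so extension-closed classes contain it.
\<close>

sublocale additive_ideal \<B> "T \<inter> U"
proof
  show "Z \<in> T \<inter> U" if "is_zero_object \<B> Z" for Z
    using that cotorsion_right_zero[OF ST] cotorsion_left_zero[OF UV] by blast
  show "P \<in> T \<inter> U" if "is_biproduct \<B> A B P i j p q" "A \<in> T \<inter> U" "B \<in> T \<inter> U" for A B P i j p q
    using cotorsion_right_extension[OF ST realz_zero[OF that(1)]]
      cotorsion_left_extension[OF UV realz_zero[OF that(1)]] that by blast
qed

end

section \<open>Hearts of twin cotorsion pairs\<close>

context twin_cotorsion
begin

abbreviation "Bplus \<equiv> cone_class \<B> V (T \<inter> U)"
abbreviation "Bminus \<equiv> cocone_class \<B> (T \<inter> U) S"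
abbreviation "Bminus1 \<equiv> cocone_class \<B> (T \<inter> S) S"

text \<open>
  Negligible morphisms act as zero on \<open>\<E>(s, -)\<close>, which vanishes on \<open>T\<close>.
\<close>

lemma push_ideal:
  assumes s: "s \<in> S" and f: "f \<in> I A B" and o: "A \<in> Obj \<B>" "B \<in> Obj \<B>"
    and \<theta>: "\<theta> \<in> carrier (Ext \<B> s A)"
  shows "push \<B> s f \<theta> = \<one>\<^bsub>Ext \<B> s B\<^esub>"
proof -
  obtain Z u v where "Z \<in> T \<inter> U" "arr \<B> A Z u" "arr \<B> Z B v" "f = v \<cdot> u" using f o idealE by metis
  then show ?thesis using push_through_vanishing[OF ST_vanish[OF s] _ _ sets_obj(1)[OF s] \<theta>] by blast
qed

text \<open>
  Let \<open>v \<rightarrow> u \<rightarrow> X\<close> be the triangle of \<open>(U, V)\<close>; the point is \<open>u \<in> T\<close>. The factorization of the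
  identity of \<open>X\<close> through \<open>Y\<close>, up to a morphism through \<open>T \<inter> U\<close>, lifts to \<open>u\<close>: up to a map through \<open>v\<close>,
  the identity of \<open>u\<close> is a sum of maps through objects of \<open>T \<inter> U\<close>. As \<open>v \<in> V \<subseteq> T\<close> too, pushing
  forward along the identity of \<open>u\<close> kills every class in \<open>\<E>(S, u)\<close>.
\<close>

lemma plus_retract:
  assumes Y: "Y \<in> Bplus" and f: "arr \<B> X Y f" and g: "arr \<B> Y X g"
    and gf: "diff \<B> X X (g \<cdot> f) (Ident \<B> X) \<in> I X X"
  shows "X \<in> Bplus"
proof -
  note X = arrD(1)[OF f]
  note idX = arr_ident[OF X] and gfa = arr_cmp[OF f g]
  obtain v0 w0 x0 y0 \<delta>0 where t0: "v0 \<in> V" "w0 \<in> T \<inter> U" "realizes \<B> v0 x0 w0 y0 Y \<delta>0"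
    using Y cone_classE by metis
  note d0 = realizesD[OF t0(3)]
  obtain v u x y \<delta> where t: "v \<in> V" "u \<in> U" "realizes \<B> v x u y X \<delta>"
    using UV X unfolding cotorsion_pair_def E_triangle_def by metis
  note d = realizesD[OF t(3)]
  obtain z a b where z: "z \<in> T \<inter> U" "arr \<B> X z a" "arr \<B> z X b"
      "diff \<B> X X (Ident \<B> X) (g \<cdot> f) = b \<cdot> a"
    using idealE[OF ideal_diff_sym[OF gf gfa idX] X X] by metis
  have id: "Ident \<B> X = (g \<cdot> f) \<otimes>\<^bsub>Hom \<B> X X\<^esub> (b \<cdot> a)"
    using diff_add(2)[OF idX gfa] z(4) by simp
  \<comment> \<open>The maps \<open>f y\<close>, \<open>g y0\<close> and \<open>b\<close> lift along the deflations with fibre in \<open>V\<close>.\<close>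
  obtain l where l: "arr \<B> u w0 l" "y0 \<cdot> l = f \<cdot> y"
    using lifts_if_vanishes[OF t0(3) arr_cmp[OF d(2) f] UV_vanish[OF t(2) t0(1)]] by blast
  obtain m where m: "arr \<B> w0 u m" "y \<cdot> m = g \<cdot> y0"
    using lifts_if_vanishes[OF t(3) arr_cmp[OF d0(2) g] UV_vanish[OF _ t(1)]] t0(2) by blast
  obtain n where n: "arr \<B> z u n" "y \<cdot> n = b"
    using lifts_if_vanishes[OF t(3) z(3) UV_vanish[OF _ t(1)]] z(1) by blast
  note ml = arr_cmp[OF l(1) m(1)] and ay = arr_cmp[OF d(2) z(2)]
  note nay = arr_cmp[OF ay n(1)]
  define e where "e = (m \<cdot> l) \<otimes>\<^bsub>Hom \<B> u u\<^esub> (n \<cdot> (a \<cdot> y))"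
  have e: "arr \<B> u u e" unfolding e_def by (rule arr_add[OF ml nay])
  have "y = ((g \<cdot> f) \<cdot> y) \<otimes>\<^bsub>Hom \<B> u X\<^esub> ((b \<cdot> a) \<cdot> y)"
    using ident_cmp[OF d(2)] add_cmp[OF d(2) gfa arr_cmp[OF z(2,3)]] id by simp
  also have "(g \<cdot> f) \<cdot> y = y \<cdot> (m \<cdot> l)"
    using assoc[OF d(2) f g] assoc[OF l(1) d0(2) g] assoc[OF l(1) m(1) d(2)] l(2) m(2) by simp
  also have "(b \<cdot> a) \<cdot> y = y \<cdot> (n \<cdot> (a \<cdot> y))"
    using assoc[OF d(2) z(2,3)] assoc[OF ay n(1) d(2)] n(2) by simp
  finally have "y = y \<cdot> e" unfolding e_def using cmp_add[OF ml nay d(2)] by simp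
  note idu = arr_ident[OF d(5)]
  have "y \<cdot> diff \<B> u u (Ident \<B> u) e = zero_mor \<B> u X"
    using cmp_diff[OF idu e d(2)] \<open>y = y \<cdot> e\<close> cmp_ident[OF d(2)] diff_self[OF d(2)] by simp
  then obtain r where r: "arr \<B> u v r" "x \<cdot> r = diff \<B> u u (Ident \<B> u) e"
    using factors_through_inflation[OF t(3) arr_diff[OF idu e]] by blast
  have id': "Ident \<B> u = e \<otimes>\<^bsub>Hom \<B> u u\<^esub> (x \<cdot> r)" using diff_add(2)[OF idu e] r(2) by simp
  have "u \<in> T"
    unfolding cotorsion_right_iff[OF ST]
  proof (intro conjI ballI)
    show "u \<in> Obj \<B>" using d by simp
    fix s assume s: "s \<in> S"
    note s' = sets_obj(1)[OF s]
    have "\<theta> = \<one>\<^bsub>Ext \<B> s u\<^esub>" if \<theta>: "\<theta> \<in> carrier (Ext \<B> s u)" for \<theta>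
    proof -
      interpret E: group "Ext \<B> s u" using ext_group[OF s' d(5)] .
      have 1: "push \<B> s (m \<cdot> l) \<theta> = \<one>\<^bsub>Ext \<B> s u\<^esub>"
        using push_through_vanishing[OF ST_vanish[OF s] l(1) m(1) s' \<theta>] t0(2) by blast
      have 2: "push \<B> s (n \<cdot> (a \<cdot> y)) \<theta> = \<one>\<^bsub>Ext \<B> s u\<^esub>"
        using push_through_vanishing[OF ST_vanish[OF s] ay n(1) s' \<theta>] z(1) by blast
      have 3: "push \<B> s (x \<cdot> r) \<theta> = \<one>\<^bsub>Ext \<B> s u\<^esub>"
        using push_through_vanishing[OF ST_vanish[OF s] r(1) d(1) s' \<theta>] t(1) VT by blast
      have "push \<B> s e \<theta> = \<one>\<^bsub>Ext \<B> s u\<^esub>"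
        unfolding e_def push_add[OF ml nay s' \<theta>] 1 2 by simp
      then have "push \<B> s (Ident \<B> u) \<theta> = \<one>\<^bsub>Ext \<B> s u\<^esub>"
        unfolding id' push_add[OF e arr_cmp[OF r(1) d(1)] s' \<theta>] 3 by simp
      then show ?thesis using push_ident[OF d(5) s' \<theta>] by simp
    qed
    then show "ext_vanishes \<B> s u" using ext_one_closed[OF s' d(5)] by blast
  qed
  then show ?thesis using cone_classI[OF t(1) _ t(3)] t(2) by blast
qed

text \<open>
  Cover the middle term of \<open>v \<rightarrow> w \<rightarrow> X\<close> by \<open>t\<^sub>0 \<rightarrow> s \<rightarrow> w\<close>. The dual of (ET4) makes \<open>s \<rightarrow> w \<rightarrow> X\<close> a deflation
  whose fibre is an extension of \<open>v\<close> by \<open>t\<^sub>0\<close>, hence in \<open>T\<close>.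
\<close>

lemma plus_subset_plus1: "Bplus \<subseteq> cone_class \<B> T (T \<inter> S)"
proof
  fix X assume "X \<in> Bplus"
  then obtain v w x y \<delta> where t: "v \<in> V" "w \<in> T \<inter> U" "realizes \<B> v x w y X \<delta>" using cone_classE by metis
  obtain t0 s x0 y0 \<delta>0 where t0: "t0 \<in> T" "s \<in> S" "realizes \<B> t0 x0 s y0 w \<delta>0"
    using ST realizesD(5)[OF t(3)] unfolding cotorsion_pair_def E_triangle_def by metis
  have s: "s \<in> T" using cotorsion_right_extension[OF ST t0(3,1)] t(2) by blast
  obtain E e d h \<delta>1 \<delta>2 where E: "realizes \<B> E h s (y \<cdot> y0) X \<delta>1" "realizes \<B> t0 e E d v \<delta>2"
    using ET4_opD[OF t(3) t0(3)] by metis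
  have "E \<in> T" using cotorsion_right_extension[OF ST E(2) t0(1)] t(1) VT by blast
  then show "X \<in> cone_class \<B> T (T \<inter> S)" using cone_classI[OF _ _ E(1)] s t0(2) by blast
qed

lemma minus1_subset_minus: "Bminus1 \<subseteq> Bminus"
  using SU by (auto simp: cocone_class_def)

text \<open>
  It suffices to embed \<open>C\<close> into some \<open>P \<in> S\<close> with cone in \<open>S\<close>, since \<open>P\<close> in turn embeds into an object of
  \<open>S \<inter> T\<close> with cone in \<open>S\<close>, and (ET4) composes the two. Such a \<open>P\<close> is the pushout along \<open>Y \<rightarrow> C\<close> of the
  given embedding \<open>Y \<rightarrow> m\<close>: a class on \<open>P\<close> with values in \<open>T\<close> restricts to zero on \<open>m\<close>, hence on \<open>Y\<close>,
  hence on \<open>C\<close> because \<open>C\<close> differs from \<open>Y\<close> by an object of \<open>S\<close>, and finally on \<open>P\<close> for the same reason.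
\<close>

lemma minus1_inflation:
  assumes Y: "Y \<in> Bminus1" and r: "realizes \<B> Y q C p s \<delta>" and s: "s \<in> S"
  shows "C \<in> Bminus1"
proof -
  note d = realizesD[OF r]
  obtain s0 m x y \<delta>0 where t0: "s0 \<in> S" "m \<in> T \<inter> S" "realizes \<B> Y x m y s0 \<delta>0"
    using Y cocone_classE by metis
  note d0 = realizesD[OF t0(3)]
  \<comment> \<open>\<open>C \<rightarrow> P \<rightarrow> s0\<close> is the pushout of \<open>Y \<rightarrow> m \<rightarrow> s0\<close> along \<open>q\<close>.\<close>
  obtain z P w where P: "realizes \<B> C z P w s0 (push \<B> s0 q \<delta>0)"
    using realz_exists[OF d(5) d0(6) push_closed[OF d(1) d0(6,3)]] by blast
  note dP = realizesD[OF P]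
  have "push \<B> s0 q \<delta>0 = pull \<B> C (Ident \<B> s0) (push \<B> s0 q \<delta>0)"
    using ext_map_ident[OF d(5) d0(6) push_closed[OF d(1) d0(6,3)]] by (simp add: pull_def)
  then obtain b where b: "b \<in> hom_set \<B> m P" "b \<cdot> x = z \<cdot> q"
    using realz_morphism[OF t0(3) P arrD(3)[OF d(1)] arrD(3)[OF arr_ident[OF d0(6)]]] by blast
  have b': "arr \<B> m P b" using b(1) d0 dP by (simp add: arr_def)
  have PS: "P \<in> S"
    unfolding cotorsion_left_iff[OF ST]
  proof (intro conjI ballI)
    show "P \<in> Obj \<B>" using dP by simp
    fix t assume t: "t \<in> T"
    note t' = sets_obj(2)[OF t]
    have "\<theta> = \<one>\<^bsub>Ext \<B> P t\<^esub>" if \<theta>: "\<theta> \<in> carrier (Ext \<B> P t)" for \<theta>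
    proof -
      note c = pull_closed[OF dP(1) t' \<theta>]
      have "pull \<B> t q (pull \<B> t z \<theta>) = pull \<B> t x (pull \<B> t b \<theta>)"
        using pull_cmp[OF dP(1) d(1) t' \<theta>] pull_cmp[OF b' d0(1) t' \<theta>] b(2) by simp
      also have "\<dots> = \<one>\<^bsub>Ext \<B> Y t\<^esub>"
        using pull_closed[OF b' t' \<theta>] ST_vanish[OF _ t] t0(2) pull_one[OF d0(1) t'] by auto
      finally obtain \<eta> where \<eta>: "\<eta> \<in> carrier (Ext \<B> s t)" "pull \<B> t p \<eta> = pull \<B> t z \<theta>"
        using ext_exact_middle[OF r t' c] by blast
      then have "pull \<B> t z \<theta> = \<one>\<^bsub>Ext \<B> C t\<^esub>" using ST_vanish[OF s t] pull_one[OF d(2) t'] by simp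
      then obtain \<zeta> where "\<zeta> \<in> carrier (Ext \<B> s0 t)" "pull \<B> t w \<zeta> = \<theta>"
        using ext_exact_middle[OF P t' \<theta>] by blast
      then show ?thesis using ST_vanish[OF t0(1) t] pull_one[OF dP(2) t'] by simp
    qed
    then show "ext_vanishes \<B> P t" using ext_one_closed[OF dP(5) t'] by blast
  qed
  obtain t1 s1 x1 y1 \<delta>1 where t1: "t1 \<in> T" "s1 \<in> S" "realizes \<B> P x1 t1 y1 s1 \<delta>1"
    using ST dP(5) unfolding cotorsion_pair_def E_triangle_def by metis
  have t1S: "t1 \<in> S" using cotorsion_left_extension[OF ST t1(3) PS t1(2)] .
  obtain E d e h \<delta>2 \<delta>3 where E: "realizes \<B> C (x1 \<cdot> z) t1 h E \<delta>2" "realizes \<B> s0 d E e s1 \<delta>3"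
    using ET4D[OF P t1(3)] by metis
  have "E \<in> S" using cotorsion_left_extension[OF ST E(2) t0(1) t1(2)] .
  then show ?thesis using cocone_classI[OF _ _ E(1)] t1(1) t1S by blast
qed

text \<open>
  Take \<open>v \<rightarrow> u \<rightarrow> C\<close> and embed \<open>u\<close> by \<open>u \<rightarrow> w \<rightarrow> s\<close> into \<open>w \<in> T\<close>; then \<open>w \<in> T \<inter> U\<close>, and (ET4) produces
  \<open>v \<rightarrow> w \<rightarrow> D\<close> together with \<open>C \<rightarrow> D \<rightarrow> s\<close>. A map \<open>h : C \<rightarrow> Z\<close> to an object of \<open>\<B>\<^sup>+\<close> becomes, on \<open>u\<close>, a map
  through \<open>T \<inter> U\<close>, so the obstruction to extending it to \<open>D\<close> vanishes.
\<close>

lemma plus_reflection: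
  assumes C: "C \<in> Obj \<B>"
  obtains D c p s \<delta> where "D \<in> Bplus" "s \<in> S" "realizes \<B> C c D p s \<delta>"
    "\<And>Z h. Z \<in> Bplus \<Longrightarrow> arr \<B> C Z h \<Longrightarrow> \<exists>k. arr \<B> D Z k \<and> k \<cdot> c = h"
proof -
  obtain v u x y \<delta> where t: "v \<in> V" "u \<in> U" "realizes \<B> v x u y C \<delta>"
    using UV C unfolding cotorsion_pair_def E_triangle_def by metis
  note d = realizesD[OF t(3)]
  obtain w s x0 y0 \<delta>0 where t0: "w \<in> T" "s \<in> S" "realizes \<B> u x0 w y0 s \<delta>0"
    using ST d(5) unfolding cotorsion_pair_def E_triangle_def by metis
  note d0 = realizesD[OF t0(3)]
  have w: "w \<in> U" using cotorsion_left_extension[OF UV t0(3) t(2)] t0(2) SU by blast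
  obtain D c p h \<delta>1 where D: "realizes \<B> v (x0 \<cdot> x) w h D \<delta>1" "realizes \<B> C c D p s (push \<B> s y \<delta>0)"
    using ET4D[OF t(3) t0(3)] by metis
  have "D \<in> Bplus" using cone_classI[OF t(1) _ D(1)] t0(1) w by blast
  moreover have "\<exists>k. arr \<B> D Z k \<and> k \<cdot> c = h" if Z: "Z \<in> Bplus" and h: "arr \<B> C Z h" for Z h
  proof -
    obtain v' w' x' y' \<delta>' where t': "v' \<in> V" "w' \<in> T \<inter> U" "realizes \<B> v' x' w' y' Z \<delta>'"
      using Z cone_classE by metis
    obtain l where l: "arr \<B> u w' l" "y' \<cdot> l = h \<cdot> y"
      using lifts_if_vanishes[OF t'(3) arr_cmp[OF d(2) h] UV_vanish[OF t(2) t'(1)]] by blast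
    have "push \<B> s h (push \<B> s y \<delta>0) = push \<B> s (y' \<cdot> l) \<delta>0"
      using push_cmp[OF d(2) h d0(6,3)] l(2) by simp
    also have "\<dots> = \<one>\<^bsub>Ext \<B> s Z\<^esub>"
      using push_through_vanishing[OF ST_vanish[OF t0(2)] l(1) realizesD(2)[OF t'(3)] d0(6,3)] t'(2) by blast
    finally show ?thesis using extends_iff_push[OF D(2) h] by blast
  qed
  ultimately show ?thesis using that D(2) t0(2) by blast
qed

text \<open>
  Subtracting from \<open>t\<close> an extension of \<open>t c\<close> through \<open>T \<inter> U\<close> leaves a map that factors through the cone
  \<open>s\<close>; and every map from \<open>S\<close> to \<open>Z \<in> \<B>\<^sup>+\<close> lifts to the middle term of the triangle of \<open>Z\<close>.
\<close>

lemma inflation_epi_on_plus: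
  assumes r: "realizes \<B> Y c C p s \<delta>" and s: "s \<in> S" and Z: "Z \<in> Bplus"
    and t: "arr \<B> C Z t" and tc: "t \<cdot> c \<in> I Y Z"
  shows "t \<in> I C Z"
proof -
  note d = realizesD[OF r] and Z' = arrD(2)[OF t]
  obtain z a b where z: "z \<in> T \<inter> U" "arr \<B> Y z a" "arr \<B> z Z b" "t \<cdot> c = b \<cdot> a"
    using idealE[OF tc d(4) Z'] by metis
  obtain k where k: "arr \<B> C z k" "k \<cdot> c = a"
    using extends_if_vanishes[OF r z(2) ST_vanish[OF s]] z(1) by blast
  note bk = arr_cmp[OF k(1) z(3)]
  have "diff \<B> C Z t (b \<cdot> k) \<cdot> c = zero_mor \<B> Y Z"
    using diff_cmp[OF d(1) t bk] assoc[OF d(1) k(1) z(3)] k(2) z(4) diff_self[OF arr_cmp[OF z(2,3)]] by simp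
  then obtain l where l: "arr \<B> s Z l" "l \<cdot> p = diff \<B> C Z t (b \<cdot> k)"
    using factors_through_deflation[OF r arr_diff[OF t bk]] by blast
  obtain v w x y \<delta>' where w: "v \<in> V" "w \<in> T \<inter> U" "realizes \<B> v x w y Z \<delta>'" using Z cone_classE by metis
  obtain m where m: "arr \<B> s w m" "y \<cdot> m = l"
    using lifts_if_vanishes[OF w(3) l(1) UV_vanish[OF _ w(1)]] s SU by blast
  have "l \<in> I s Z" using idealI[OF w(2) m(1) realizesD(2)[OF w(3)]] m(2) by simp
  then have "diff \<B> C Z t (b \<cdot> k) \<in> I C Z" using ideal_cmp_right[OF _ Z' d(2)] l(2) by metis
  then show ?thesis using diff_ideal_iff[OF idealI[OF z(1) k(1) z(3)] t] by simp
qed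

text \<open>
  Cover the middle term of \<open>X \<rightarrow> w \<rightarrow> s\<close> by \<open>t\<^sub>0 \<rightarrow> s\<^sub>0 \<rightarrow> w\<close>. The fibre \<open>E\<close> of \<open>s\<^sub>0 \<rightarrow> w \<rightarrow> s\<close> lies in \<open>\<B>\<^sub>1\<^sup>-\<close>, and
  the class of \<open>X \<rightarrow> w \<rightarrow> s\<close> is pushed forward from it along \<open>f : E \<rightarrow> X\<close>; so if \<open>k f\<close> is negligible, then
  \<open>k\<close> extends along \<open>X \<rightarrow> w\<close> and is negligible itself. Reflecting \<open>E\<close> into \<open>\<B>\<^sup>+\<close> gives \<open>Y\<close>.
\<close>

lemma epi_from_minus1:
  assumes X: "X \<in> Bplus" "X \<in> Bminus"
  obtains Y \<alpha> where "Y \<in> Bplus" "Y \<in> Bminus1" "arr \<B> Y X \<alpha>"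
    "\<And>Z h. arr \<B> X Z h \<Longrightarrow> h \<cdot> \<alpha> \<in> I Y Z \<Longrightarrow> h \<in> I X Z"
proof -
  obtain s w x y \<delta> where t: "s \<in> S" "w \<in> T \<inter> U" "realizes \<B> X x w y s \<delta>" using X(2) cocone_classE by metis
  note d = realizesD[OF t(3)]
  obtain t0 s0 x0 y0 \<delta>0 where t0: "t0 \<in> T" "s0 \<in> S" "realizes \<B> t0 x0 s0 y0 w \<delta>0"
    using ST d(5) unfolding cotorsion_pair_def E_triangle_def by metis
  have s0: "s0 \<in> T" using cotorsion_right_extension[OF ST t0(3,1)] t(2) by blast
  obtain E f h \<delta>1 where E: "arr \<B> E X f" "realizes \<B> E h s0 (y \<cdot> y0) s \<delta>1" "push \<B> s f \<delta>1 = \<delta>"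
    using ET4_opD[OF t(3) t0(3)] by metis
  note dE = realizesD[OF E(2)]
  have E1: "E \<in> Bminus1" using cocone_classI[OF t(1) _ E(2)] s0 t0(2) by blast
  have f_epi: "k \<in> I X Z" if k: "arr \<B> X Z k" and kf: "k \<cdot> f \<in> I E Z" for Z k
  proof -
    have "push \<B> s k \<delta> = push \<B> s (k \<cdot> f) \<delta>1" using push_cmp[OF E(1) k dE(6,3)] E(3) by simp
    also have "\<dots> = \<one>\<^bsub>Ext \<B> s Z\<^esub>" using push_ideal[OF t(1) kf dE(4) arrD(2)[OF k] dE(3)] .
    finally obtain j where "arr \<B> w Z j" "j \<cdot> x = k" using extends_iff_push[OF t(3) k] by blast
    then show ?thesis using idealI[OF t(2) d(1)] by blast
  qed
  obtain Y c p s1 \<delta>2 where Y: "Y \<in> Bplus" "s1 \<in> S" "realizes \<B> E c Y p s1 \<delta>2"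
    "\<And>Z h. Z \<in> Bplus \<Longrightarrow> arr \<B> E Z h \<Longrightarrow> \<exists>k. arr \<B> Y Z k \<and> k \<cdot> c = h"
    using plus_reflection[OF dE(4)] by metis
  obtain \<alpha> where \<alpha>: "arr \<B> Y X \<alpha>" "\<alpha> \<cdot> c = f" using Y(4)[OF X(1) E(1)] by blast
  note c = realizesD(1)[OF Y(3)]
  have "k \<in> I X Z" if k: "arr \<B> X Z k" and k\<alpha>: "k \<cdot> \<alpha> \<in> I Y Z" for Z k
  proof -
    have "k \<cdot> f = (k \<cdot> \<alpha>) \<cdot> c" using assoc[OF c \<alpha>(1) k] \<alpha>(2) by simp
    then show ?thesis using f_epi[OF k] ideal_cmp_right[OF k\<alpha> arrD(2)[OF k] c] by simp
  qed
  then show ?thesis using that[OF Y(1) minus1_inflation[OF E1 Y(3,2)] \<alpha>(1)] by blast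
qed

text \<open>
  With \<open>\<alpha> : Y \<rightarrow> X\<close> as in \<open>epi_from_minus1\<close>, the cokernel of some \<open>g : A \<rightarrow> Y\<close>, the object \<open>D\<close> is the
  hand-made cokernel of \<open>g\<close> and \<open>\<pi> : Y \<rightarrow> D\<close> its projection. Comparing \<open>\<alpha>\<close> and \<open>\<pi>\<close> gives mutually
  inverse maps between \<open>X\<close> and \<open>D\<close>: \<open>\<phi>\<close> exists because \<open>\<alpha>\<close> is a cokernel, and \<open>\<psi>\<close> because \<open>\<alpha> g\<close> pushes the
  class of \<open>A\<close> to zero and \<open>X \<in> \<B>\<^sup>+\<close>.
\<close>

theorem heart_dense_first:
  assumes ek: "epis_are_cokernels \<B> (T \<inter> U) (heart_objects \<B> S T U V)"
    and X: "X \<in> heart_objects \<B> S T U V"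
  shows "\<exists>D \<in> single_heart_objects \<B> S T. isomorphic Q X D"
proof -
  let ?H = "heart_objects \<B> S T U V"
  have Hp: "Z \<in> Bplus" if "Z \<in> ?H" for Z using that by (simp add: heart_objects_def)
  have X': "X \<in> Bplus" "X \<in> Bminus" using X by (auto simp: heart_objects_def)
  obtain Y \<alpha> where Y: "Y \<in> Bplus" "Y \<in> Bminus1" and \<alpha>: "arr \<B> Y X \<alpha>"
    and epi: "\<And>Z h. arr \<B> X Z h \<Longrightarrow> h \<cdot> \<alpha> \<in> I Y Z \<Longrightarrow> h \<in> I X Z"
    using epi_from_minus1[OF X'] by metis
  have YH: "Y \<in> ?H" using Y minus1_subset_minus by (auto simp: heart_objects_def)
  obtain A g where A: "A \<in> ?H" and g: "arr \<B> A Y g" and \<alpha>g: "\<alpha> \<cdot> g \<in> I A X"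
    and ck: "\<And>Z h. Z \<in> ?H \<Longrightarrow> arr \<B> Y Z h \<Longrightarrow> h \<cdot> g \<in> I A Z \<Longrightarrow>
      \<exists>k. arr \<B> X Z k \<and> diff \<B> Y Z (k \<cdot> \<alpha>) h \<in> I Y Z"
    using ek[unfolded epis_are_cokernels_def, rule_format, of X Y \<alpha>] X YH \<alpha> epi by metis
  obtain s w x y \<delta> where t: "s \<in> S" "w \<in> T \<inter> U" "realizes \<B> A x w y s \<delta>"
    using A cocone_classE[of A "T \<inter> U" S] unfolding heart_objects_def by blast
  note d = realizesD[OF t(3)]
  note pc = push_closed[OF g d(6,3)]
  obtain c C p where C: "realizes \<B> Y c C p s (push \<B> s g \<delta>)"
    using realz_exists[OF arrD(2)[OF g] d(6) pc] by blast
  note dC = realizesD[OF C]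
  obtain D j p' s' \<delta>' where D: "D \<in> Bplus" "s' \<in> S" "realizes \<B> C j D p' s' \<delta>'"
    "\<And>Z h. Z \<in> Bplus \<Longrightarrow> arr \<B> C Z h \<Longrightarrow> \<exists>k. arr \<B> D Z k \<and> k \<cdot> j = h"
    using plus_reflection[OF dC(5)] by metis
  note dD = realizesD[OF D(3)]
  have D1: "D \<in> Bminus1" using minus1_inflation[OF minus1_inflation[OF Y(2) C t(1)] D(3,2)] .
  have DH: "D \<in> ?H" using D(1) D1 minus1_subset_minus by (auto simp: heart_objects_def)
  have DH1: "D \<in> single_heart_objects \<B> S T"
    using D(1) D1 plus_subset_plus1 by (auto simp: heart_objects_def)
  define \<pi> where "\<pi> = j \<cdot> c"
  have \<pi>: "arr \<B> Y D \<pi>" unfolding \<pi>_def by (rule arr_cmp[OF dC(1) dD(1)])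
  have \<pi>_epi: "k \<in> I D Z" if k: "arr \<B> D Z k" "k \<cdot> \<pi> \<in> I Y Z" and Z: "Z \<in> Bplus" for Z k
  proof -
    have "(k \<cdot> j) \<cdot> c \<in> I Y Z" using k(2) assoc[OF dC(1) dD(1) k(1)] by (simp add: \<pi>_def)
    then have "k \<cdot> j \<in> I C Z" using inflation_epi_on_plus[OF C t(1) Z arr_cmp[OF dD(1) k(1)]] by blast
    then show ?thesis using inflation_epi_on_plus[OF D(3,2) Z k(1)] by blast
  qed
  have "\<pi> \<cdot> g \<in> I A D"
  proof -
    note cg = arr_cmp[OF g dC(1)]
    have "push \<B> s (c \<cdot> g) \<delta> = \<one>\<^bsub>Ext \<B> s C\<^esub>"
      using push_cmp[OF g dC(1) d(6,3)] push_inflation[OF C] by simp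
    then obtain k where k: "arr \<B> w C k" "k \<cdot> x = c \<cdot> g" using extends_iff_push[OF t(3) cg] by blast
    have "c \<cdot> g \<in> I A C" using idealI[OF t(2) d(1) k(1)] k(2) by simp
    then show ?thesis using ideal_cmp_left[OF _ d(4) dD(1)] assoc[OF g dC(1) dD(1)] by (simp add: \<pi>_def)
  qed
  then obtain \<phi> where \<phi>: "arr \<B> X D \<phi>" "diff \<B> Y D (\<phi> \<cdot> \<alpha>) \<pi> \<in> I Y D"
    using ck[OF DH \<pi>] by blast
  obtain \<psi> where \<psi>: "arr \<B> D X \<psi>" "\<psi> \<cdot> \<pi> = \<alpha>"
  proof -
    have "push \<B> s \<alpha> (push \<B> s g \<delta>) = \<one>\<^bsub>Ext \<B> s X\<^esub>"
      using push_cmp[OF g \<alpha> d(6,3)] push_ideal[OF t(1) \<alpha>g d(4) arrD(2)[OF \<alpha>] d(3)] by simp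
    then obtain k where k: "arr \<B> C X k" "k \<cdot> c = \<alpha>" using extends_iff_push[OF C \<alpha>] by blast
    obtain l where l: "arr \<B> D X l" "l \<cdot> j = k" using D(4)[OF X'(1) k(1)] by blast
    then show ?thesis using that[OF l(1)] k assoc[OF dC(1) dD(1) l(1)] by (simp add: \<pi>_def)
  qed
  note \<phi>\<alpha> = arr_cmp[OF \<alpha> \<phi>(1)] and \<psi>\<phi> = arr_cmp[OF \<phi>(1) \<psi>(1)] and \<phi>\<psi> = arr_cmp[OF \<psi>(1) \<phi>(1)]
  note idX = arr_ident[OF arrD(2)[OF \<alpha>]] and idD = arr_ident[OF dD(5)]
  have "diff \<B> X X (\<psi> \<cdot> \<phi>) (Ident \<B> X) \<in> I X X"
  proof (rule epi[OF arr_diff[OF \<psi>\<phi> idX]])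
    have "diff \<B> X X (\<psi> \<cdot> \<phi>) (Ident \<B> X) \<cdot> \<alpha> = \<psi> \<cdot> diff \<B> Y D (\<phi> \<cdot> \<alpha>) \<pi>"
      using diff_cmp[OF \<alpha> \<psi>\<phi> idX] cmp_diff[OF \<phi>\<alpha> \<pi> \<psi>(1)] assoc[OF \<alpha> \<phi>(1) \<psi>(1)] ident_cmp[OF \<alpha>] \<psi>(2)
      by simp
    then show "diff \<B> X X (\<psi> \<cdot> \<phi>) (Ident \<B> X) \<cdot> \<alpha> \<in> I Y X"
      using ideal_cmp_left[OF \<phi>(2) arrD(1)[OF \<alpha>] \<psi>(1)] by simp
  qed
  moreover have "diff \<B> D D (\<phi> \<cdot> \<psi>) (Ident \<B> D) \<in> I D D"
  proof (rule \<pi>_epi[OF arr_diff[OF \<phi>\<psi> idD] _ D(1)])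
    have "diff \<B> D D (\<phi> \<cdot> \<psi>) (Ident \<B> D) \<cdot> \<pi> = diff \<B> Y D (\<phi> \<cdot> \<alpha>) \<pi>"
      using diff_cmp[OF \<pi> \<phi>\<psi> idD] assoc[OF \<pi> \<psi>(1) \<phi>(1)] ident_cmp[OF \<pi>] \<psi>(2) by simp
    then show "diff \<B> D D (\<phi> \<cdot> \<psi>) (Ident \<B> D) \<cdot> \<pi> \<in> I Y D" using \<phi>(2) by simp
  qed
  ultimately have "isomorphic Q X D" unfolding quotient_isomorphic_iff using \<phi>(1) \<psi>(1) by blast
  then show ?thesis using DH1 by blast
qed

lemma heart_objects_opp: "heart_objects (opp \<B>) V U T S = heart_objects \<B> S T U V"
  using cone_class_opp cocone_class_opp unfolding heart_objects_def by (auto simp: Int_commute)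

lemma single_heart_objects_opp: "single_heart_objects (opp \<B>) V U = single_heart_objects \<B> U V"
  using cone_class_opp cocone_class_opp unfolding heart_objects_def by (auto simp: Int_commute)

lemma quotient_isomorphic_opp:
  assumes "isomorphic (ideal_quotient (opp \<B>) (T \<inter> U)) X Y"
  shows "isomorphic Q X Y"
proof -
  interpret op: twin_cotorsion "opp \<B>" V U T S by (rule twin_cotorsion_opp)
  show ?thesis
    using assms unfolding Int_commute[of T U] op.quotient_isomorphic_iff
    unfolding Int_commute[of U T] quotient_isomorphic_iff by auto
qed

lemma minus_retract:
  assumes "Y \<in> Bminus" "arr \<B> X Y f" "arr \<B> Y X g" "diff \<B> X X (g \<cdot> f) (Ident \<B> X) \<in> I X X"
  shows "X \<in> Bminus"
  using twin_cotorsion.plus_retract[OF twin_cotorsion_opp, of Y X g f] assms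
  by (simp add: cone_class_opp Int_commute)

lemma plus_quotient_iso: "isomorphic Q X Y \<Longrightarrow> Y \<in> Bplus \<Longrightarrow> X \<in> Bplus"
  unfolding quotient_isomorphic_iff using plus_retract by blast

lemma minus_quotient_iso: "isomorphic Q X Y \<Longrightarrow> Y \<in> Bminus \<Longrightarrow> X \<in> Bminus"
  unfolding quotient_isomorphic_iff using minus_retract by blast

lemma isomorphic_refl: "X \<in> Obj \<B> \<Longrightarrow> isomorphic Q X X"
  unfolding quotient_isomorphic_iff
  using arr_ident[of X] ident_cmp[OF arr_ident, of X] diff_self[OF arr_ident, of X] zero_in_ideal[of X X] by metis

lemma subset_underline: "D \<subseteq> Obj \<B> \<Longrightarrow> D \<subseteq> underline \<B> (T \<inter> U) D"
  using isomorphic_refl by (auto simp: underline_def iso_closure_def)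

lemma heart_objects_obj: "heart_objects \<B> A B C D \<subseteq> Obj \<B>"
  by (auto simp: heart_objects_def cone_class_def)

text \<open>
  An isomorphism in \<open>\<B>/(T \<inter> U)\<close> is in particular a retraction up to negligible morphisms.
\<close>

lemma underline_heart: "underline \<B> (T \<inter> U) (heart_objects \<B> S T U V) = heart_objects \<B> S T U V"
proof
  show "underline \<B> (T \<inter> U) (heart_objects \<B> S T U V) \<subseteq> heart_objects \<B> S T U V"
    using plus_quotient_iso minus_quotient_iso
    by (auto simp: underline_def iso_closure_def heart_objects_def)
qed (rule subset_underline[OF heart_objects_obj])

text \<open>
  For the second part, the roles of kernels and cokernels are exchanged: that monomorphisms are
  kernels is the hypothesis of \<open>heart_dense_first\<close> for the opposite category.
\<close>

lemma heart_abelian_dense: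
  assumes ab: "abelian_category (heart \<B> S T U V)" and X: "X \<in> heart_objects \<B> S T U V"
  shows "\<exists>D \<in> single_heart_objects \<B> S T. isomorphic Q X D"
    "\<exists>D \<in> single_heart_objects \<B> U V. isomorphic Q X D"
proof -
  let ?H = "heart_objects \<B> S T U V"
  have ab': "abelian_category (full_subcat Q ?H)" using ab by (simp add: heart_def underline_heart)
  show "\<exists>D \<in> single_heart_objects \<B> S T. isomorphic Q X D"
    using heart_dense_first[OF abelian_epis_are_cokernels[OF ab' heart_objects_obj] X] .
  have "epis_are_cokernels (opp \<B>) (T \<inter> U) ?H"
    unfolding epis_are_cokernels_def opp_simps arr_opp factoring_opp
  proof (intro allI impI, elim conjE)
    fix X Y \<alpha> assume h: "X \<in> ?H" "Y \<in> ?H" "arr \<B> X Y \<alpha>"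
      "\<forall>Z \<in> ?H. \<forall>h. arr \<B> Z X h \<and> \<alpha> \<cdot> h \<in> I Z Y \<longrightarrow> h \<in> I Z X"
    show "\<exists>A \<in> ?H. \<exists>g. arr \<B> Y A g \<and> g \<cdot> \<alpha> \<in> I X A \<and>
      (\<forall>Z \<in> ?H. \<forall>h. arr \<B> Z Y h \<and> g \<cdot> h \<in> I Z A \<longrightarrow>
        (\<exists>k. arr \<B> Z X k \<and> diff \<B> Z Y (\<alpha> \<cdot> k) h \<in> I Z Y))"
      using abelian_monos_are_kernels[OF ab' heart_objects_obj h(1,2,3)] h(4) by blast
  qed
  then show "\<exists>D \<in> single_heart_objects \<B> U V. isomorphic Q X D"
    using twin_cotorsion.heart_dense_first[OF twin_cotorsion_opp, of X] X quotient_isomorphic_opp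
    unfolding heart_objects_opp single_heart_objects_opp Int_commute[of U T] by blast
qed

end

theorem proposition4p3:
  fixes \<B> :: "('o, 'm, 'e) extri"
    and S T U V :: "'o set"
  defines "W \<equiv> T \<inter> U"
    and "H \<equiv> heart_objects \<B> S T U V"
    and "H1 \<equiv> single_heart_objects \<B> S T"
    and "H2 \<equiv> single_heart_objects \<B> U V"
  assumes "extriangulated_category \<B>"
    and "twin_cotorsion_pair \<B> S T U V"
    and "abelian_category (heart \<B> S T U V)"
  shows "dense_in (ideal_quotient \<B> W) (underline \<B> W H1) (underline \<B> W H) \<and>
         dense_in (ideal_quotient \<B> W) (underline \<B> W H2) (underline \<B> W H) \<and>
         (krull_schmidt \<B> \<longrightarrow> underline \<B> W H = underline \<B> W H1 \<inter> underline \<B> W H2)"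
proof -
  interpret extriangulated_category \<B> by fact
  interpret twin_cotorsion \<B> S T U V by unfold_locales fact
  note dense = heart_abelian_dense[OF assms(7), folded H_def H1_def H2_def W_def]
  have uH: "underline \<B> W H = H" unfolding W_def H_def by (rule underline_heart)
  have H_obj: "H \<subseteq> Obj \<B>" "H1 \<subseteq> Obj \<B>" "H2 \<subseteq> Obj \<B>"
    unfolding H_def H1_def H2_def by (rule heart_objects_obj)+
  then have sub: "H1 \<subseteq> underline \<B> W H1" "H2 \<subseteq> underline \<B> W H2"
    unfolding W_def by (auto intro: subset_underline[THEN subsetD])
  have "H \<subseteq> underline \<B> W H1 \<inter> underline \<B> W H2"
    using dense H_obj unfolding underline_def iso_closure_def by (auto simp: W_def)
  moreover have "underline \<B> W H1 \<inter> underline \<B> W H2 \<subseteq> H"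
  proof
    fix X assume X: "X \<in> underline \<B> W H1 \<inter> underline \<B> W H2"
    then obtain Y1 Y2 where Y: "Y1 \<in> H1" "isomorphic Q X Y1" "Y2 \<in> H2" "isomorphic Q X Y2"
      unfolding underline_def iso_closure_def W_def by blast
    have "Y1 \<in> Bminus" using Y(1) minus1_subset_minus unfolding H1_def heart_objects_def by blast
    moreover have "Y2 \<in> Bplus" using Y(3) VT unfolding H2_def heart_objects_def cone_class_def by blast
    ultimately show "X \<in> H"
      using plus_quotient_iso[OF Y(4)] minus_quotient_iso[OF Y(2)] by (simp add: H_def heart_objects_def)
  qed
  ultimately have "H = underline \<B> W H1 \<inter> underline \<B> W H2" by blast
  moreover have "dense_in (ideal_quotient \<B> W) (underline \<B> W H1) H" "dense_in (ideal_quotient \<B> W) (underline \<B> W H2) H"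
    using dense sub unfolding dense_in_def by blast+
  ultimately show ?thesis using uH by simp
qed

end
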